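(* Let $\mathcal{H}$ be a finite-dimensional Hilbert space, let $\mathcal{O}\in\mathcal{L}(\mathcal{H})$ be an observable (Hermitian operator), and let $n\geq 1$ be an integer. There is a quantum algorithm (a measurement on $\mathcal{H}^{\otimes n}$ depending only on $\mathcal{O}$ and $n$) that, given $n$ samples of an unknown quantum state $\rho$ on $\mathcal{H}$ (i.e., the state $\rho^{\otimes n}$), outputs a list of real numbers $p_1,p_2,\ldots,p_n$ such that for every $1\leq k\leq n$, \[\mathbf{E}[p_k]=\operatorname{tr}(\mathcal{O}\rho^k)\qquad\text{and}\qquad \mathbf{Var}[p_k]\leq \frac{2k\|\mathcal{O}\|^2}{n},\] where $\|\mathcal{O}\|$ is the operator norm of $\mathcal{O}$.
   Context: $\mathcal{L}(\mathcal{H})$ denotes the set of linear operators on $\mathcal{H}$. A "sample" of $\rho$ is one copy of $\rho$; the algorithm may apply an arbitrary joint quantum measurement to all copies. Expectations and variances are over the randomness of the measurement outcome. *)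

theory Defs
  imports "Jordan_Normal_Form.Schur_Decomposition"
begin

text \<open>The Hilbert space H is modelled as C^d; operators on it are complex d x d matrices
 (Jordan_Normal_Form). Conjugate transpose is the library's mat_adjoint.\<close>

definition hermitian_mat :: "nat \<Rightarrow> complex mat \<Rightarrow> bool" where
  "hermitian_mat d A \<longleftrightarrow> A \<in> carrier_mat d d \<and> mat_adjoint A = A"

definition cinner :: "complex vec \<Rightarrow> complex vec \<Rightarrow> complex" where
  "cinner v w = (\<Sum>i<dim_vec v. cnj (v $ i) * w $ i)"

definition vnorm :: "complex vec \<Rightarrow> real" where
  "vnorm v = sqrt (\<Sum>i<dim_vec v. (cmod (v $ i))^2)"

definition op_norm :: "complex mat \<Rightarrow> real" where
  "op_norm A = Sup {vnorm (A *\<^sub>v v) | v. dim_vec v = dim_col A \<and> vnorm v = 1}"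

definition psd_mat :: "nat \<Rightarrow> complex mat \<Rightarrow> bool" where
  "psd_mat d A \<longleftrightarrow> hermitian_mat d A \<and>
     (\<forall>v. dim_vec v = d \<longrightarrow> Im (cinner v (A *\<^sub>v v)) = 0 \<and> Re (cinner v (A *\<^sub>v v)) \<ge> 0)"

definition mtrace :: "complex mat \<Rightarrow> complex" where
  "mtrace A = (\<Sum>i<dim_row A. A $$ (i,i))"

definition density_mat :: "nat \<Rightarrow> complex mat \<Rightarrow> bool" where
  "density_mat d \<rho> \<longleftrightarrow> psd_mat d \<rho> \<and> mtrace \<rho> = 1"

definition kron :: "complex mat \<Rightarrow> complex mat \<Rightarrow> complex mat" where
  "kron A B = mat (dim_row A * dim_row B) (dim_col A * dim_col B)
     (\<lambda>(i,j). A $$ (i div dim_row B, j div dim_col B) * B $$ (i mod dim_row B, j mod dim_col B))"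

fun tensor_pow :: "complex mat \<Rightarrow> nat \<Rightarrow> complex mat" where
  "tensor_pow A 0 = 1\<^sub>m 1"
| "tensor_pow A (Suc n) = kron (tensor_pow A n) A"

definition povm :: "nat \<Rightarrow> real list set \<Rightarrow> (real list \<Rightarrow> complex mat) \<Rightarrow> bool" where
  "povm D X M \<longleftrightarrow> finite X \<and> (\<forall>x\<in>X. psd_mat D (M x)) \<and>
     (\<forall>i<D. \<forall>j<D. (\<Sum>x\<in>X. M x $$ (i,j)) = (1\<^sub>m D) $$ (i,j))"

text \<open>Born rule: probability of outcome x when measuring state \<sigma>.\<close>
definition outcome_prob :: "(real list \<Rightarrow> complex mat) \<Rightarrow> complex mat \<Rightarrow> real list \<Rightarrow> real" where
  "outcome_prob M \<sigma> x = Re (mtrace (M x * \<sigma>))"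

definition meas_expect :: "real list set \<Rightarrow> (real list \<Rightarrow> complex mat) \<Rightarrow> complex mat \<Rightarrow> (real list \<Rightarrow> real) \<Rightarrow> real" where
  "meas_expect X M \<sigma> f = (\<Sum>x\<in>X. outcome_prob M \<sigma> x * f x)"

definition meas_var :: "real list set \<Rightarrow> (real list \<Rightarrow> complex mat) \<Rightarrow> complex mat \<Rightarrow> (real list \<Rightarrow> real) \<Rightarrow> real" where
  "meas_var X M \<sigma> f = (\<Sum>x\<in>X. outcome_prob M \<sigma> x * (f x - meas_expect X M \<sigma> f)^2)"

end

theory Submission
  imports Defs "HOL-Combinatorics.Orbits"
begin

text \<open>For \<open>c\<close> the cycle on the first \<open>k\<close> positions, the operator \<open>O\<^sub>1 U\<^sub>c\<close> on \<open>n\<close> copies of \<open>H\<close> has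
  expectation \<open>tr (O \<rho>\<^sup>k)\<close> in the state \<open>\<rho>\<close> taken \<open>n\<close> times. Its average \<open>P\<^sub>k\<close> over the conjugations by
  all permutations is the quantum analogue of a U-statistic. Every permutation is conjugate to its
  inverse by a permutation that preserves two prescribed positions as a set; hence the average of any
  \<open>O\<^sub>i O\<^sub>j U\<^sub>p\<close> is Hermitian, and so is every product \<open>P\<^sub>k P\<^sub>l\<close>. So the \<open>P\<^sub>k\<close> commute and can be measured
  jointly. The variance bound is Hoeffding's: \<open>P\<^sub>k\<close> is an average of means over \<open>n div k\<close> disjoint
  blocks of \<open>k\<close> copies, each of variance at most \<open>\<parallel>O\<parallel>\<^sup>2 / (n div k)\<close>, and \<open>n div k \<ge> n / (2 k)\<close>.\<close>

text \<open>A product \<open>P\<^sub>k P\<^sub>l\<close> contains the observable twice, at positions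
  that can lie anywhere in the cycles of the combined permutation. That a permutation is conjugate
  to its inverse is therefore not enough: the conjugation must respect both marks. A reflection of a
  cycle can exchange two given points or fix one, and an exchange is harmless because both marks
  carry the same observable. Three marks on one cycle need not admit such a reflection, so the
  argument is tied to products of two estimators. Once the product is Hermitian, it equals its
  adjoint \<open>P\<^sub>l P\<^sub>k\<close>.

  The block means in Hoeffding's argument are in general neither Hermitian nor commuting, so they
  are not random variables to which Jensen's inequality applies. A factorisation of the state turns
  the second moment into a squared norm, and convexity of that norm takes the place of
  Jensen.\<close>

unbundle no m_inv_syntax

section \<open>Inverting a permutation by conjugation\<close>

text \<open>A cycle is a polygon rotated by \<open>p\<close>, and each of its reflections inverts
  the rotation. One reflection exchanges two given points of the cycle, and one fixes a given point.
  The first is used if \<open>i\<close> and \<open>j\<close> share a cycle, the second in the cycle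
  of each of them if they do not.\<close>

lemma permutes_inverted_by_involution:
  fixes p :: "'a \<Rightarrow> 'a" and i j :: 'a
  assumes p: "p permutes A" and fin: "finite A"
  obtains q where "q permutes A" "q \<circ> p \<circ> inv q = inv p"
    "q i = i \<and> q j = j \<or> q i = j \<and> q j = i"
proof -
  have perm: "permutation p" using permutes_imp_permutation[OF fin p] .
  have bp: "bij p" using p by (rule permutes_bij)
  have inj: "inj (p ^^ m)" for m using bp by (simp add: bij_is_inj inj_fn)
  have pinv: "(p ^^ m) ((inv p ^^ m) z) = z" for m z
    using bij_fn[OF bp, of m] inv_fn[OF bp, of m] by (metis bij_inv_eq_iff)
  have invp: "(inv p ^^ m) ((p ^^ m) z) = z" for m z
    by (metis inj injD pinv)
  have orb: "orbit p x = {(p ^^ m) x | m. True}" for x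
    by (rule orbit_altdef_permutation[OF perm])
  have self: "x \<in> orbit p x" for x by (rule permutation_self_in_orbit[OF perm])
  have orb_eq: "orbit p y = orbit p x" if "y \<in> orbit p x" for x y
    using that self by (meson orbit_subset orbit_swap subset_antisym subsetI orbit_trans)
  \<comment> \<open>\<open>f x\<close> is a base point of the cycle of \<open>x\<close> and
    \<open>g x\<close> the mirror image of that base point; both depend on the cycle only. Below,
    \<open>q\<close> sends the point \<open>m\<close> steps after \<open>f x\<close> to the point
    \<open>m\<close> steps before \<open>g x\<close>.\<close>
  define f where "f x = (if i \<in> orbit p x then i else if j \<in> orbit p x then j
     else (SOME y. y \<in> orbit p x))" for x
  define g where "g x = (if i \<in> orbit p x then (if j \<in> orbit p x then j else i) else f x)" for x
  have fo: "f x \<in> orbit p x" for x unfolding f_def using self[of x] by (auto intro: someI)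
  have go: "g x \<in> orbit p x" for x unfolding g_def using fo by auto
  have fg_eq: "f y = f x" "g y = g x" if "y \<in> orbit p x" for x y
    unfolding f_def g_def orb_eq[OF that] by auto
  have ex_m: "\<exists>m. x = (p ^^ m) (f x)" for x
    using orbit_swap[OF self fo[of x]] orb by blast
  have ex_c: "\<exists>c. g x = (p ^^ c) (f x)" for x
    using go[of x] orb_eq[OF fo[of x]] orb by blast
  define q where "q x = (inv p ^^ (SOME m. x = (p ^^ m) (f x))) (g x)" for x
  have q: "q x = (inv p ^^ m) (g x)" if m: "x = (p ^^ m) (f x)" for x m
  proof -
    define m' where "m' = (SOME m. x = (p ^^ m) (f x))"
    have m': "x = (p ^^ m') (f x)" unfolding m'_def using ex_m by (rule someI_ex)
    obtain c where c: "g x = (p ^^ c) (f x)" using ex_c by blast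
    \<comment> \<open>Two exponents that reach \<open>x\<close> from \<open>f x\<close> act alike on
      \<open>g x\<close>, because \<open>g x\<close> is a power of \<open>p\<close> applied to
      \<open>f x\<close>. The two candidates for \<open>q x\<close> are compared after the injective
      map \<open>p ^^ (m + m')\<close>.\<close>
    have "(p ^^ (m + m')) ((inv p ^^ m) (g x)) = (p ^^ m') (g x)"
      by (metis add.commute comp_apply funpow_add pinv)
    also have "\<dots> = (p ^^ c) x" using c m'
      by (metis add.commute comp_apply funpow_add)
    also have "\<dots> = (p ^^ m) (g x)" using c m
      by (metis add.commute comp_apply funpow_add)
    also have "\<dots> = (p ^^ (m + m')) ((inv p ^^ m') (g x))"
      by (metis comp_apply funpow_add pinv)
    finally show ?thesis using inj[of "m + m'"] unfolding q_def m'_def[symmetric]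
      by (metis injD)
  qed
  have qo: "q x \<in> orbit p x" for x
  proof -
    obtain m where m: "x = (p ^^ m) (f x)" using ex_m by blast
    have "g x \<in> orbit p (q x)" using pinv[of m "g x"] q[OF m] orb[of "q x"] by (auto intro!: exI[of _ m])
    then show ?thesis using go orb_eq self by metis
  qed
  have qq: "q (q x) = x" for x
  proof -
    obtain m where m: "x = (p ^^ m) (f x)" using ex_m by blast
    obtain m2 where m2: "q x = (p ^^ m2) (f (q x))" using ex_m by blast
    have e: "f (q x) = f x" "g (q x) = g x" using fg_eq[OF qo] by auto
    have "g x = (p ^^ m) (q x)" using pinv q[OF m] by simp
    also have "\<dots> = (p ^^ m2) ((p ^^ m) (f x))" using m2 e
      by (metis add.commute comp_apply funpow_add)
    finally have "g x = (p ^^ m2) x" using m by simp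
    then show ?thesis using q[OF m2] e invp by simp
  qed
  have inv_q: "inv q = q" using qq by (metis inv_equality)
  have qp: "q (p x) = inv p (q x)" for x
  proof -
    obtain m where m: "x = (p ^^ m) (f x)" using ex_m by blast
    have o: "p x \<in> orbit p x" by (rule orbit.base)
    have "p x = (p ^^ Suc m) (f (p x))" using m fg_eq[OF o] by simp
    from q[OF this] fg_eq[OF o] q[OF m] show ?thesis by simp
  qed
  have "q permutes A"
  proof (rule bij_imp_permutes)
    have out: "q x = x" if "x \<notin> A" for x
      using qo[of x] that p permutes_not_in orbit_eq_singleton_iff by (metis singletonD)
    have "q x \<in> A" if "x \<in> A" for x using qq out that by metis
    then show "bij_betw q A A" by (intro bij_betw_byWitness[of _ q]) (auto simp: qq)
    show "q x = x" if "x \<notin> A" for x by (rule out[OF that])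
  qed
  moreover have "q \<circ> p \<circ> inv q = inv p" unfolding inv_q by (auto simp: fun_eq_iff qp qq)
  moreover have dis: "q i = i \<and> q j = j \<or> q i = j \<and> q j = i"
  proof -
    have fi: "f i = i" using self by (simp add: f_def)
    have qi: "q i = g i" using q[of i 0] fi by simp
    show ?thesis
    proof (cases "j \<in> orbit p i")
      case True
      then have "q i = j" using qi self by (simp add: g_def)
      then show ?thesis using qq by metis
    next
      case False
      then have "i \<notin> orbit p j" using orb_eq self by metis
      then have "f j = j" "g j = j" using self by (auto simp: f_def g_def)
      moreover have "q i = i" using qi False self by (simp add: g_def)
      ultimately show ?thesis using q[of j 0] by simp
    qed
  qed
  ultimately show thesis using that by blast
qed

section \<open>Joint spectral resolution of commuting Hermitian kernels\<close>

text \<open>Matrices are functions on an arbitrary index set here, because the same algebra is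
  needed for words and for the indices of a matrix of size \<open>d ^ n\<close>.\<close>

definition kmul :: "'a set \<Rightarrow> ('a \<Rightarrow> 'a \<Rightarrow> complex) \<Rightarrow> ('a \<Rightarrow> 'a \<Rightarrow> complex) \<Rightarrow> 'a \<Rightarrow> 'a \<Rightarrow> complex" where
  "kmul W K L a b = (\<Sum>c\<in>W. K a c * L c b)"

definition kadj :: "('a \<Rightarrow> 'a \<Rightarrow> complex) \<Rightarrow> 'a \<Rightarrow> 'a \<Rightarrow> complex" where
  "kadj K a b = cnj (K b a)"

definition kid :: "'a set \<Rightarrow> 'a \<Rightarrow> 'a \<Rightarrow> complex" where
  "kid W a b = (if a = b \<and> a \<in> W then 1 else 0)"

text \<open>Vanishing off \<open>W\<close> lets the entries on \<open>W\<close> determine the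
  kernel, so that operator identities become equalities of functions.\<close>

definition kernel_on :: "'a set \<Rightarrow> ('a \<Rightarrow> 'a \<Rightarrow> complex) \<Rightarrow> bool" where
  "kernel_on W K \<longleftrightarrow> (\<forall>a b. \<not> (a \<in> W \<and> b \<in> W) \<longrightarrow> K a b = 0)"

lemma kmul_assoc: "kmul W (kmul W K L) M = kmul W K (kmul W L M)"
proof (intro ext)
  fix a b
  have "kmul W (kmul W K L) M a b = (\<Sum>c\<in>W. \<Sum>e\<in>W. K a e * (L e c * M c b))"
    by (simp add: kmul_def sum_distrib_right mult.assoc)
  also have "\<dots> = (\<Sum>e\<in>W. \<Sum>c\<in>W. K a e * (L e c * M c b))" by (rule sum.swap)
  finally show "kmul W (kmul W K L) M a b = kmul W K (kmul W L M) a b"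
    by (simp add: kmul_def sum_distrib_left)
qed

lemma kmul_sum_left: "kmul W (\<lambda>a b. \<Sum>i\<in>I. F i a b) L = (\<lambda>a b. \<Sum>i\<in>I. kmul W (F i) L a b)"
  unfolding kmul_def sum_distrib_right by (intro ext, rule sum.swap)

lemma kmul_sum_right: "kmul W K (\<lambda>a b. \<Sum>i\<in>I. F i a b) = (\<lambda>a b. \<Sum>i\<in>I. kmul W K (F i) a b)"
  unfolding kmul_def sum_distrib_left by (intro ext, rule sum.swap)

lemma kmul_scale_left: "kmul W (\<lambda>a b. c * K a b) L = (\<lambda>a b. c * kmul W K L a b)"
  by (simp add: kmul_def sum_distrib_left mult.assoc fun_eq_iff)

lemma kmul_scale_right: "kmul W K (\<lambda>a b. c * L a b) = (\<lambda>a b. c * kmul W K L a b)"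
  by (simp add: kmul_def sum_distrib_left mult.left_commute fun_eq_iff)

lemma kmul_diff_right: "kmul W K (\<lambda>a b. L a b - M a b) = (\<lambda>a b. kmul W K L a b - kmul W K M a b)"
  by (simp add: kmul_def right_diff_distrib sum_subtractf fun_eq_iff)

lemma kmul_diff_left: "kmul W (\<lambda>a b. L a b - M a b) K = (\<lambda>a b. kmul W L K a b - kmul W M K a b)"
  by (simp add: kmul_def left_diff_distrib sum_subtractf fun_eq_iff)

lemma kadj_kmul: "kadj (kmul W K L) = kmul W (kadj L) (kadj K)"
  by (simp add: kmul_def kadj_def fun_eq_iff mult.commute)

lemma kadj_kadj [simp]: "kadj (kadj K) = K"
  by (simp add: kadj_def fun_eq_iff)

lemma kernel_on_zero: "kernel_on W K \<Longrightarrow> \<not> (a \<in> W \<and> b \<in> W) \<Longrightarrow> K a b = 0"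
  unfolding kernel_on_def by blast

lemma kernel_on_kmul: "kernel_on W K \<Longrightarrow> kernel_on W L \<Longrightarrow> kernel_on W (kmul W K L)"
  unfolding kernel_on_def kmul_def by (auto intro!: sum.neutral)

lemma kernel_on_kadj: "kernel_on W K \<Longrightarrow> kernel_on W (kadj K)"
  unfolding kernel_on_def kadj_def by auto

lemma kmul_kid_left:
  assumes "finite W" "kernel_on W K"
  shows "kmul W (kid W) K = K"
proof (intro ext)
  fix a b
  have "kmul W (kid W) K a b = (\<Sum>c\<in>W. if c = a then K c b else 0)"
    unfolding kmul_def kid_def by (intro sum.cong) auto
  then show "kmul W (kid W) K a b = K a b"
    using assms kernel_on_zero[OF assms(2)] by (simp add: sum.delta)
qed

lemma kmul_kid_right:
  assumes "finite W" "kernel_on W K"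
  shows "kmul W K (kid W) = K"
proof -
  have "kadj (kid W) = kid W" by (auto simp: kadj_def kid_def fun_eq_iff)
  then have "kadj (kmul W K (kid W)) = kadj K"
    using kmul_kid_left[OF assms(1) kernel_on_kadj[OF assms(2)]] by (simp add: kadj_kmul)
  then show ?thesis by (metis kadj_kadj)
qed

text \<open>The diagonal entries of the Gram kernel are the squared norms of the columns of
  \<open>K\<close>.\<close>

lemma kernel_eq_0_if_gram_0:
  assumes W: "finite W" and K: "kernel_on W K" and 0: "kmul W (kadj K) K = (\<lambda>a b. 0)"
  shows "K = (\<lambda>a b. 0)"
proof (intro ext)
  fix a b
  have "(\<Sum>c\<in>W. (cmod (K c b))\<^sup>2) = Re (kmul W (kadj K) K b b)"
    by (simp add: kmul_def kadj_def mult.commute[of "cnj _"] complex_mult_cnj cmod_power2)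
  then have "(\<Sum>c\<in>W. (cmod (K c b))\<^sup>2) = 0" by (simp add: 0)
  then have "\<forall>c\<in>W. (cmod (K c b))\<^sup>2 = 0" using W by (subst (asm) sum_nonneg_eq_0_iff) auto
  then show "K a b = 0" using K by (cases "a \<in> W") (auto simp: kernel_on_def)
qed

text \<open>Column by column, \<open>X\<close> is a sum of eigenvectors of \<open>A\<close> with
  real eigenvalues. A general \<open>X\<close> permits induction; for the identity this is
  diagonalisability.\<close>

definition eigen_split :: "'a set \<Rightarrow> ('a \<Rightarrow> 'a \<Rightarrow> complex) \<Rightarrow> ('a \<Rightarrow> 'a \<Rightarrow> complex) \<Rightarrow> bool" where
  "eigen_split W A X \<longleftrightarrow> (\<exists>(S :: real set) C. finite S \<and>
     (\<forall>s\<in>S. kernel_on W (C s) \<and> kmul W A (C s) = (\<lambda>a b. of_real s * C s a b)) \<and>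
     X = (\<lambda>a b. \<Sum>s\<in>S. C s a b))"

text \<open>Dividing the part with eigenvalue \<open>s\<close> by \<open>s - e\<close> solves for
  \<open>X\<close> up to a remainder \<open>Y\<close> such that the columns of
  \<open>(A - e) Y\<close> lie in the eigenspace of \<open>e\<close>. A Hermitian \<open>A\<close>
  has no Jordan blocks, so \<open>Y\<close> is itself an eigenpart, or zero if \<open>e\<close> is
  not real.\<close>

lemma eigen_split_shift:
  assumes W: "finite W" and A: "kernel_on W A" and herm: "kadj A = A" and X: "kernel_on W X"
    and split: "eigen_split W A (\<lambda>a b. kmul W A X a b - e * X a b)"
  shows "eigen_split W A X"
proof -
  obtain S :: "real set" and B where S: "finite S"
    and B: "\<And>s. s \<in> S \<Longrightarrow> kernel_on W (B s)"
    and AB: "\<And>s. s \<in> S \<Longrightarrow> kmul W A (B s) = (\<lambda>a b. of_real s * B s a b)"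
    and sum: "(\<lambda>a b. kmul W A X a b - e * X a b) = (\<lambda>a b. \<Sum>s\<in>S. B s a b)"
    using split unfolding eigen_split_def by blast
  define T where "T = {s\<in>S. complex_of_real s \<noteq> e}"
  have T: "finite T" "T \<subseteq> S" using S by (auto simp: T_def)
  define C where "C s = (\<lambda>a b. (1 / (of_real s - e)) * B s a b)" for s
  have C: "kernel_on W (C s)" if "s \<in> T" for s
    using B that T by (auto simp: C_def kernel_on_def)
  have AC: "kmul W A (C s) = (\<lambda>a b. of_real s * C s a b)" if "s \<in> T" for s
    unfolding C_def kmul_scale_right using AB[of s] that T by (auto simp: fun_eq_iff)
  define Y where "Y = (\<lambda>a b. X a b - (\<Sum>s\<in>T. C s a b))"
  have Y: "kernel_on W Y" using X C by (simp add: Y_def kernel_on_def)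
  have XY: "X = (\<lambda>a b. Y a b + (\<Sum>s\<in>T. C s a b))" by (simp add: Y_def)
  define Z where "Z = (\<lambda>a b. kmul W A Y a b - e * Y a b)"
  have Z: "kernel_on W Z" using kernel_on_kmul[OF A Y] Y by (simp add: Z_def kernel_on_def)
  have Zsum: "Z a b = (\<Sum>s\<in>S - T. B s a b)" for a b
  proof -
    have "Z a b = (kmul W A X a b - e * X a b) - (\<Sum>s\<in>T. of_real s * C s a b - e * C s a b)"
      unfolding Z_def Y_def
      by (simp add: kmul_diff_right kmul_sum_right AC algebra_simps sum_subtractf sum_distrib_left)
    also have "(\<Sum>s\<in>T. of_real s * C s a b - e * C s a b) = (\<Sum>s\<in>T. B s a b)"
      unfolding left_diff_distrib[symmetric] by (intro sum.cong) (auto simp: C_def T_def)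
    also have "kmul W A X a b - e * X a b = (\<Sum>s\<in>S. B s a b)" using sum by (simp add: fun_eq_iff)
    finally show ?thesis using sum_diff[OF S T(2), of "\<lambda>s. B s a b"] by simp
  qed
  have AZ: "kmul W A Z = (\<lambda>a b. e * Z a b)"
  proof -
    have "kmul W A Z = (\<lambda>a b. \<Sum>s\<in>S - T. of_real s * B s a b)"
      unfolding Zsum[abs_def] kmul_sum_right by (simp add: AB)
    also have "\<dots> = (\<lambda>a b. \<Sum>s\<in>S - T. e * B s a b)"
      by (intro ext sum.cong) (auto simp: T_def)
    finally show ?thesis by (simp add: Zsum[abs_def] sum_distrib_left)
  qed
  show ?thesis
  proof (cases "e \<in> \<real>")
    case True
    then obtain r where r: "e = of_real r" by (auto elim: Reals_cases)
    \<comment> \<open>For real \<open>e\<close> the operator \<open>A - e\<close> is its own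
      adjoint, so the Gram kernel of \<open>Z\<close> is the adjoint of \<open>Y\<close> times
      \<open>(A - e) Z\<close>, which vanishes.\<close>
    have "kadj Z = (\<lambda>a b. kmul W (kadj Y) A a b - e * kadj Y a b)"
      using kadj_kmul[of W A Y] unfolding herm by (simp add: Z_def fun_eq_iff r kadj_def)
    then have "kmul W (kadj Z) Z = (\<lambda>a b. 0)"
      by (simp add: kmul_diff_left kmul_scale_left kmul_assoc AZ kmul_scale_right)
    then have "Z = (\<lambda>a b. 0)" by (rule kernel_eq_0_if_gram_0[OF W Z])
    then have AY: "kmul W A Y = (\<lambda>a b. of_real r * Y a b)"
      by (simp add: Z_def fun_eq_iff r)
    have rT: "r \<notin> T" by (simp add: T_def r)
    show ?thesis unfolding eigen_split_def
    proof (intro exI conjI)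
      show "finite (insert r T)" using T by simp
      show "\<forall>s\<in>insert r T. kernel_on W ((C(r := Y)) s) \<and>
          kmul W A ((C(r := Y)) s) = (\<lambda>a b. of_real s * (C(r := Y)) s a b)"
        using AY Y C AC rT by auto
      have "(\<Sum>s\<in>T. (C(r := Y)) s a b) = (\<Sum>s\<in>T. C s a b)" for a b
        using rT by (intro sum.cong) auto
      then show "X = (\<lambda>a b. \<Sum>s\<in>insert r T. (C(r := Y)) s a b)"
        using rT T by (subst XY) simp
    qed
  next
    case False
    \<comment> \<open>A real label never equals \<open>e\<close>, so nothing obstructs the division.
      Multiplying the adjoint of \<open>Y\<close>, \<open>A\<close> and \<open>Y\<close> and
      evaluating \<open>A\<close> on either side then forces \<open>Y\<close> to be zero.\<close>
    have "S - T = {}" using False by (auto simp: T_def)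
    then have "Z = (\<lambda>a b. 0)" unfolding Zsum[abs_def] by (simp only: sum.empty)
    then have AY: "kmul W A Y = (\<lambda>a b. e * Y a b)" by (simp add: Z_def fun_eq_iff)
    have "kmul W (kadj Y) A = (\<lambda>a b. cnj e * kadj Y a b)"
      using arg_cong[OF AY, of kadj] unfolding kadj_kmul herm by (simp add: kadj_def fun_eq_iff)
    then have "(\<lambda>a b. cnj e * kmul W (kadj Y) Y a b) = (\<lambda>a b. e * kmul W (kadj Y) Y a b)"
      using kmul_assoc[of W "kadj Y" A Y] by (simp add: AY kmul_scale_left kmul_scale_right)
    moreover have "cnj e \<noteq> e" using False by (metis Reals_cnj_iff)
    ultimately have "kmul W (kadj Y) Y = (\<lambda>a b. 0)" by (simp add: fun_eq_iff)
    then have "Y = (\<lambda>a b. 0)" by (rule kernel_eq_0_if_gram_0[OF W Y])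
    then show ?thesis unfolding eigen_split_def using XY T C AC by (intro exI[of _ T] exI[of _ C]) auto
  qed
qed

section \<open>The spectral theorem for Hermitian matrices\<close>

definition kernel_of_mat :: "nat \<Rightarrow> complex mat \<Rightarrow> nat \<Rightarrow> nat \<Rightarrow> complex" where
  "kernel_of_mat D A i j = (if i < D \<and> j < D then A $$ (i,j) else 0)"

lemma kernel_on_kernel_of_mat [simp]: "kernel_on {..<D} (kernel_of_mat D A)"
  by (auto simp: kernel_on_def kernel_of_mat_def)

lemma kernel_of_mat_mult:
  assumes "A \<in> carrier_mat D D" "B \<in> carrier_mat D D"
  shows "kernel_of_mat D (A * B) = kmul {..<D} (kernel_of_mat D A) (kernel_of_mat D B)"
  using assms by (auto simp: kernel_of_mat_def kmul_def scalar_prod_def fun_eq_iff atLeast0LessThan)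

lemma kernel_of_mat_one: "kernel_of_mat D (1\<^sub>m D) = kid {..<D}"
  by (auto simp: kernel_of_mat_def kid_def fun_eq_iff)

lemma kernel_of_mat_mat:
  "kernel_on {..<D :: nat} K \<Longrightarrow> kernel_of_mat D (mat D D (\<lambda>(i,j). K i j)) = K"
  by (auto simp: kernel_of_mat_def kernel_on_def fun_eq_iff)

text \<open>Schur triangulation turns the eigenvalue problem into back substitution: on a triangular
  matrix, subtracting the k-th diagonal entry kills the k-th row of whatever lives in the first
  k rows.\<close>

lemma eigen_split_kid:
  fixes K :: "nat \<Rightarrow> nat \<Rightarrow> complex"
  assumes K: "kernel_on {..<D} K" and herm: "kadj K = K"
  shows "eigen_split {..<D} K (kid {..<D})"
proof -
  let ?W = "{..<D}"
  define A where "A = mat D D (\<lambda>(i,j). K i j)"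
  have A: "A \<in> carrier_mat D D" by (simp add: A_def)
  have KA: "kernel_of_mat D A = K" unfolding A_def by (rule kernel_of_mat_mat[OF K])
  obtain es where es: "char_poly A = (\<Prod>e\<leftarrow>es. [:- e, 1:])" using char_poly_factorized[OF A] by blast
  obtain B P Q where BPQ: "schur_decomposition A es = (B, P, Q)" by (cases "schur_decomposition A es")
  have sim: "similar_mat_wit A B P Q" and tri: "upper_triangular B"
    using schur_decomposition[OF A es BPQ] by auto
  have car: "B \<in> carrier_mat D D" "P \<in> carrier_mat D D" "Q \<in> carrier_mat D D"
    and PQ: "P * Q = 1\<^sub>m D" and QP: "Q * P = 1\<^sub>m D" and APBQ: "A = P * B * Q"
    using sim A by (auto simp: similar_mat_wit_def Let_def)
  have "A * P = P * B * (Q * P)" unfolding APBQ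
    using car by (simp add: assoc_mult_mat[of _ D D _ D _ D])
  then have AP: "A * P = P * B" using car by (simp add: QP)
  define p b q where "p = kernel_of_mat D P" and "b = kernel_of_mat D B" and "q = kernel_of_mat D Q"
  have Kp: "kmul ?W K p = kmul ?W p b"
    using arg_cong[OF AP, of "kernel_of_mat D"] car A
    by (simp add: kernel_of_mat_mult KA p_def b_def)
  have pq: "kmul ?W p q = kid ?W"
    using arg_cong[OF PQ, of "kernel_of_mat D"] car
    by (simp add: kernel_of_mat_mult kernel_of_mat_one p_def q_def)
  have p: "kernel_on ?W p" by (simp add: p_def)
  \<comment> \<open>\<open>X\<close> holds coordinates in the Schur basis given by the columns of
    \<open>p\<close>. The case \<open>k = D\<close>, \<open>X = q\<close> yields the identity, since
    \<open>q\<close> is the inverse of \<open>p\<close>.\<close>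
  have "eigen_split ?W K (kmul ?W p X)"
    if "k \<le> D" "\<And>i c. X i c \<noteq> 0 \<Longrightarrow> i < k \<and> c < D" for k X
    using that
  proof (induction k arbitrary: X)
    case 0
    then have "X i c = 0" for i c by blast
    then have "kmul ?W p X = (\<lambda>a b. 0)" by (simp add: kmul_def fun_eq_iff)
    then show ?case unfolding eigen_split_def by (intro exI[of _ "{}"]) auto
  next
    case (Suc k)
    have k: "k < D" using Suc.prems by simp
    have X0: "X i c = 0" if "k < i \<or> \<not> c < D" for i c using Suc.prems(2)[of i c] that by (cases "X i c = 0") auto
    define e where "e = b k k"
    define X' where "X' = (\<lambda>i c. kmul ?W b X i c - e * X i c)"
    have row: "X' i c = 0" if "k \<le> i" for i c
    proof (cases "i = k")
      case True
      have "kmul ?W b X k c = (\<Sum>j\<in>?W. if j = k then b k k * X k c else 0)"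
        unfolding kmul_def
      proof (intro sum.cong refl)
        fix j assume "j \<in> ?W"
        then show "b k j * X j c = (if j = k then b k k * X k c else 0)"
          using X0[of j c] tri car k by (cases j k rule: linorder_cases)
            (auto simp: b_def kernel_of_mat_def upper_triangular_def)
      qed
      then show ?thesis using k True by (simp add: X'_def e_def)
    next
      case False
      have "b i j * X j c = 0" if "j \<in> ?W" for j
        using X0[of j c] tri car False \<open>k \<le> i\<close>
        by (cases "j \<le> k") (auto simp: b_def kernel_of_mat_def upper_triangular_def)
      then have "kmul ?W b X i c = 0" unfolding kmul_def by (intro sum.neutral) blast
      then show ?thesis using X0[of i c] False \<open>k \<le> i\<close> by (simp add: X'_def)
    qed
    have "X' i c \<noteq> 0 \<Longrightarrow> i < k \<and> c < D" for i c
      using row[of i c] X0[of _ c] by (fastforce simp: X'_def kmul_def not_le[symmetric])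
    then have IH: "eigen_split ?W K (kmul ?W p X')" using Suc.IH k by simp
    have Xk: "kernel_on ?W X" using Suc.prems by (fastforce simp: kernel_on_def)
    have "kmul ?W p X' = (\<lambda>a c. kmul ?W K (kmul ?W p X) a c - e * kmul ?W p X a c)"
      unfolding X'_def kmul_diff_right kmul_scale_right kmul_assoc[symmetric] Kp ..
    with IH have "eigen_split ?W K (\<lambda>a c. kmul ?W K (kmul ?W p X) a c - e * kmul ?W p X a c)" by simp
    then show ?case by (rule eigen_split_shift[OF _ K herm kernel_on_kmul[OF p Xk], rotated]) simp
  qed
  from this[of D q] show ?thesis unfolding pq by (auto simp: q_def kernel_of_mat_def split: if_splits)
qed

text \<open>The splitting of the identity gives eigenparts \<open>E s\<close> about which no
  orthogonality is known yet. For \<open>L\<close> commuting with \<open>K\<close>, letting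
  \<open>K\<close> act to the left or to the right between the adjoint of \<open>E s\<close> and
  \<open>L (E t)\<close> shows that their product vanishes unless \<open>s = t\<close>. The choice
  \<open>L = kid\<close> makes the \<open>E s\<close> Hermitian projections; a general
  \<open>L\<close> gives the last conclusion, on which joint diagonalisation depends.\<close>

lemma hermitian_spectral_resolution:
  fixes K :: "nat \<Rightarrow> nat \<Rightarrow> complex"
  assumes K: "kernel_on {..<D} K" and herm: "kadj K = K"
  obtains S :: "real set" and E where "finite S"
    "\<And>s. s \<in> S \<Longrightarrow> kernel_on {..<D} (E s)" "\<And>s. s \<in> S \<Longrightarrow> kadj (E s) = E s"
    "\<And>s. s \<in> S \<Longrightarrow> kmul {..<D} (E s) (E s) = E s"
    "\<And>s. s \<in> S \<Longrightarrow> kmul {..<D} K (E s) = (\<lambda>a b. of_real s * E s a b)"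
    "(\<lambda>a b. \<Sum>s\<in>S. E s a b) = kid {..<D}"
    "\<And>L s. kernel_on {..<D} L \<Longrightarrow> kmul {..<D} L K = kmul {..<D} K L \<Longrightarrow> s \<in> S \<Longrightarrow>
       kmul {..<D} L (E s) = kmul {..<D} (E s) L"
proof -
  let ?W = "{..<D}"
  obtain S :: "real set" and E where S: "finite S"
    and E: "\<And>s. s \<in> S \<Longrightarrow> kernel_on ?W (E s)"
    and KE: "\<And>s. s \<in> S \<Longrightarrow> kmul ?W K (E s) = (\<lambda>a b. of_real s * E s a b)"
    and sum: "(\<lambda>a b. \<Sum>s\<in>S. E s a b) = kid ?W"
    using eigen_split_kid[OF K herm] unfolding eigen_split_def by metis
  have EK: "kmul ?W (kadj (E s)) K = (\<lambda>a b. of_real s * kadj (E s) a b)" if "s \<in> S" for s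
    using arg_cong[OF KE[OF that], of kadj] unfolding kadj_kmul herm
    by (simp add: kadj_def fun_eq_iff)
  have orth: "kmul ?W (kadj (E s)) (kmul ?W L (E t)) = (\<lambda>a b. 0)"
    if "s \<in> S" "t \<in> S" "s \<noteq> t" and L: "kmul ?W L K = kmul ?W K L" for s t L
  proof -
    have "(\<lambda>a b. of_real s * kmul ?W (kadj (E s)) (kmul ?W L (E t)) a b) =
        kmul ?W (kmul ?W (kadj (E s)) K) (kmul ?W L (E t))"
      by (simp add: EK that kmul_scale_left)
    also have "\<dots> = kmul ?W (kadj (E s)) (kmul ?W (kmul ?W K L) (E t))" by (simp add: kmul_assoc)
    also have "\<dots> = kmul ?W (kadj (E s)) (kmul ?W L (kmul ?W K (E t)))"
      unfolding L[symmetric] by (simp add: kmul_assoc)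
    also have "\<dots> = (\<lambda>a b. of_real t * kmul ?W (kadj (E s)) (kmul ?W L (E t)) a b)"
      by (simp add: KE that kmul_scale_right)
    finally show ?thesis using that by (simp add: fun_eq_iff)
  qed
  have single: "(\<lambda>a b. \<Sum>t\<in>S. F t a b) = F s"
    if "s \<in> S" "\<And>t. t \<in> S \<Longrightarrow> t \<noteq> s \<Longrightarrow> F t = (\<lambda>a b. 0)" for F :: "real \<Rightarrow> nat \<Rightarrow> nat \<Rightarrow> complex" and s
  proof (intro ext)
    fix a b
    have "(\<Sum>t\<in>S. F t a b) = (\<Sum>t\<in>{s}. F t a b)"
      using that S by (intro sum.mono_neutral_right) auto
    then show "(\<Sum>t\<in>S. F t a b) = F s a b" by simp
  qed
  have kidK: "kmul ?W (kid ?W) K = kmul ?W K (kid ?W)"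
    using K by (simp add: kmul_kid_left kmul_kid_right)
  have adjE: "kadj (E s) = kmul ?W (kadj (E s)) (E s)" if s: "s \<in> S" for s
  proof -
    have "kadj (E s) = kmul ?W (kadj (E s)) (kid ?W)"
      using E s by (simp add: kmul_kid_right kernel_on_kadj)
    also have "\<dots> = (\<lambda>a b. \<Sum>t\<in>S. kmul ?W (kadj (E s)) (E t) a b)"
      unfolding sum[symmetric] kmul_sum_right ..
    also have "\<dots> = kmul ?W (kadj (E s)) (E s)"
      using orth[OF s _ _ kidK] E s by (intro single) (auto simp: kmul_kid_left)
    finally show ?thesis .
  qed
  have hE: "kadj (E s) = E s" if s: "s \<in> S" for s
    by (metis adjE[OF s] kadj_kadj kadj_kmul)
  have idem: "kmul ?W (E s) (E s) = E s" if s: "s \<in> S" for s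
    using adjE[OF s] hE[OF s] by simp
  \<comment> \<open>Inserting the identity to the left of \<open>L (E s)\<close>, or to the right of
    \<open>E s L\<close>, leaves the same term \<open>E s L (E s)\<close>.\<close>
  have comm: "kmul ?W L (E s) = kmul ?W (E s) L"
    if L: "kernel_on ?W L" and LK: "kmul ?W L K = kmul ?W K L" and s: "s \<in> S" for L s
  proof -
    have "kmul ?W L (E s) = kmul ?W (kid ?W) (kmul ?W L (E s))"
      using L E s by (simp add: kmul_kid_left kernel_on_kmul)
    also have "\<dots> = (\<lambda>a b. \<Sum>t\<in>S. kmul ?W (E t) (kmul ?W L (E s)) a b)"
      unfolding sum[symmetric] kmul_sum_left ..
    also have "\<dots> = kmul ?W (E s) (kmul ?W L (E s))"
      using orth[OF _ s _ LK] hE s by (intro single) auto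
    also have "\<dots> = (\<lambda>a b. \<Sum>t\<in>S. kmul ?W (E s) (kmul ?W L (E t)) a b)"
      using orth[OF s _ _ LK] hE s by (intro single[symmetric]) auto
    also have "\<dots> = kmul ?W (E s) (kmul ?W L (kid ?W))"
      unfolding sum[symmetric] kmul_sum_right ..
    also have "\<dots> = kmul ?W (E s) L" using L by (simp add: kmul_kid_right)
    finally show ?thesis .
  qed
  show thesis using that[OF S E hE idem KE sum comm] by blast
qed

section \<open>Joint diagonalisation of a commuting family\<close>

definition joint_resolution ::
  "nat \<Rightarrow> nat \<Rightarrow> (nat \<Rightarrow> nat \<Rightarrow> nat \<Rightarrow> complex) \<Rightarrow> real list set \<Rightarrow> (real list \<Rightarrow> nat \<Rightarrow> nat \<Rightarrow> complex) \<Rightarrow> bool"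
  where "joint_resolution D n P X M \<longleftrightarrow> finite X \<and> (\<forall>x\<in>X. length x = n) \<and>
    (\<forall>x\<in>X. kernel_on {..<D} (M x) \<and> kadj (M x) = M x \<and> kmul {..<D} (M x) (M x) = M x) \<and>
    (\<lambda>a b. \<Sum>x\<in>X. M x a b) = kid {..<D} \<and>
    (\<forall>x\<in>X. \<forall>k<n. kmul {..<D} (P k) (M x) = (\<lambda>a b. of_real (x ! k) * M x a b)) \<and>
    (\<forall>L. kernel_on {..<D} L \<longrightarrow> (\<forall>k<n. kmul {..<D} L (P k) = kmul {..<D} (P k) L) \<longrightarrow>
       (\<forall>x\<in>X. kmul {..<D} L (M x) = kmul {..<D} (M x) L))"

lemma joint_resolutionD:
  assumes "joint_resolution D n P X M"
  shows "finite X" "x \<in> X \<Longrightarrow> length x = n" "x \<in> X \<Longrightarrow> kernel_on {..<D} (M x)"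
    "x \<in> X \<Longrightarrow> kadj (M x) = M x" "x \<in> X \<Longrightarrow> kmul {..<D} (M x) (M x) = M x"
    "(\<lambda>a b. \<Sum>x\<in>X. M x a b) = kid {..<D}"
    "x \<in> X \<Longrightarrow> k < n \<Longrightarrow> kmul {..<D} (P k) (M x) = (\<lambda>a b. of_real (x ! k) * M x a b)"
    "kernel_on {..<D} L \<Longrightarrow> (\<And>k. k < n \<Longrightarrow> kmul {..<D} L (P k) = kmul {..<D} (P k) L) \<Longrightarrow>
       x \<in> X \<Longrightarrow> kmul {..<D} L (M x) = kmul {..<D} (M x) L"
  using assms unfolding joint_resolution_def by blast+

text \<open>The projections \<open>M x\<close> for the first \<open>n\<close> operators are refined
  by the spectral projections \<open>E s\<close> of the next one. \<open>P n\<close> commutes with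
  every earlier \<open>P k\<close>, hence with every \<open>M x\<close>, and therefore every
  \<open>M x\<close> commutes with every \<open>E s\<close>. The commutation clause of
  \<open>joint_resolution\<close> carries this through the induction. The outcome is the list of
  joint eigenvalues itself.\<close>

lemma commuting_hermitian_joint_resolution:
  fixes P :: "nat \<Rightarrow> nat \<Rightarrow> nat \<Rightarrow> complex"
  assumes "\<And>k. k < n \<Longrightarrow> kernel_on {..<D} (P k)" "\<And>k. k < n \<Longrightarrow> kadj (P k) = P k"
    "\<And>k l. k < n \<Longrightarrow> l < n \<Longrightarrow> kmul {..<D} (P k) (P l) = kmul {..<D} (P l) (P k)"
  shows "\<exists>X M. joint_resolution D n P X M"
  using assms
proof (induction n)
  case 0
  have [simp]: "kernel_on {..<D} (kid {..<D})" by (auto simp: kernel_on_def kid_def)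
  have [simp]: "kadj (kid {..<D}) = kid {..<D}" by (auto simp: kadj_def kid_def fun_eq_iff)
  show ?case
    by (intro exI[of _ "{[]}"] exI[of _ "\<lambda>_. kid {..<D}"]) (auto simp: joint_resolution_def kmul_kid_left kmul_kid_right)
next
  case (Suc n)
  let ?W = "{..<D}"
  have "\<exists>X M. joint_resolution D n P X M"
    by (rule Suc.IH; rule Suc.prems; simp)
  then obtain X M where J: "joint_resolution D n P X M" by blast
  note X = joint_resolutionD(1)[OF J] and len = joint_resolutionD(2)[OF J]
    and M = joint_resolutionD(3-5)[OF J] and sumM = joint_resolutionD(6)[OF J]
    and PM = joint_resolutionD(7)[OF J] and commM = joint_resolutionD(8)[OF J]
  have Pn: "kernel_on ?W (P n)" "kadj (P n) = P n" using Suc.prems by auto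
  obtain S :: "real set" and E where S: "finite S"
    and E: "\<And>s. s \<in> S \<Longrightarrow> kernel_on ?W (E s)" "\<And>s. s \<in> S \<Longrightarrow> kadj (E s) = E s"
      "\<And>s. s \<in> S \<Longrightarrow> kmul ?W (E s) (E s) = E s"
    and PE: "\<And>s. s \<in> S \<Longrightarrow> kmul ?W (P n) (E s) = (\<lambda>a b. of_real s * E s a b)"
    and sumE: "(\<lambda>a b. \<Sum>s\<in>S. E s a b) = kid ?W"
    and commE: "\<And>L s. kernel_on ?W L \<Longrightarrow> kmul ?W L (P n) = kmul ?W (P n) L \<Longrightarrow> s \<in> S \<Longrightarrow>
       kmul ?W L (E s) = kmul ?W (E s) L"
    using hermitian_spectral_resolution[OF Pn] by blast
  have PnM: "kmul ?W (P n) (M x) = kmul ?W (M x) (P n)" if "x \<in> X" for x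
    using Suc.prems(3) by (intro commM Pn that) auto
  have ME: "kmul ?W (M x) (E s) = kmul ?W (E s) (M x)" if "x \<in> X" "s \<in> S" for x s
    using PnM that M by (intro commE) auto
  \<comment> \<open>A list in \<open>Y\<close> need not consist of joint eigenvalues. Its projection
    is zero if it does not, and the outcome then has probability 0.\<close>
  define Y where "Y = (\<lambda>(x, s). x @ [s]) ` (X \<times> S)"
  define N where "N y = kmul ?W (M (butlast y)) (E (last y))" for y
  have inj: "inj_on (\<lambda>(x, s). x @ [s]) (X \<times> S)" by (auto simp: inj_on_def)
  have sumN: "(\<lambda>a b. \<Sum>y\<in>Y. N y a b) = kid ?W"
  proof -
    have "(\<lambda>a b. \<Sum>y\<in>Y. N y a b) = (\<lambda>a b. \<Sum>(x, s)\<in>X \<times> S. kmul ?W (M x) (E s) a b)"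
      unfolding Y_def sum.reindex[OF inj] N_def by (simp add: case_prod_beta)
    also have "\<dots> = (\<lambda>a b. \<Sum>x\<in>X. \<Sum>s\<in>S. kmul ?W (M x) (E s) a b)"
      by (simp add: sum.cartesian_product)
    also have "\<dots> = (\<lambda>a b. \<Sum>x\<in>X. kmul ?W (M x) (kid ?W) a b)"
      unfolding sumE[symmetric] kmul_sum_right ..
    also have "\<dots> = (\<lambda>a b. \<Sum>x\<in>X. M x a b)" using M by (simp add: kmul_kid_right)
    finally show ?thesis using sumM by simp
  qed
  have "joint_resolution D (Suc n) P Y N" unfolding joint_resolution_def
  proof (intro conjI ballI allI impI)
    show "finite Y" using X S by (simp add: Y_def)
    show "(\<lambda>a b. \<Sum>y\<in>Y. N y a b) = kid ?W" by (rule sumN)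
    fix y assume "y \<in> Y"
    then obtain x s where y: "y = x @ [s]" and x: "x \<in> X" and s: "s \<in> S" by (auto simp: Y_def)
    have N: "N y = kmul ?W (M x) (E s)" by (simp add: N_def y)
    show "length y = Suc n" using y len x by simp
    show "kernel_on ?W (N y)" unfolding N using M E x s by (simp add: kernel_on_kmul)
    show "kadj (N y) = N y" unfolding N kadj_kmul using M E x s ME by simp
    show "kmul ?W (N y) (N y) = N y"
    proof -
      have "kmul ?W (N y) (N y) = kmul ?W (M x) (kmul ?W (kmul ?W (E s) (M x)) (E s))"
        unfolding N by (simp add: kmul_assoc)
      also have "\<dots> = kmul ?W (kmul ?W (M x) (M x)) (kmul ?W (E s) (E s))"
        unfolding ME[OF x s, symmetric] by (simp add: kmul_assoc)
      finally show ?thesis unfolding N using M E x s by simp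
    qed
    show "kmul ?W (P k) (N y) = (\<lambda>a b. of_real (y ! k) * N y a b)" if "k < Suc n" for k
    proof (cases "k = n")
      case True
      have "kmul ?W (P n) (N y) = kmul ?W (M x) (kmul ?W (P n) (E s))"
        unfolding N kmul_assoc[symmetric] PnM[OF x] ..
      then show ?thesis using True len x s y PE N by (simp add: nth_append kmul_scale_right)
    next
      case False
      then have "k < n" using that by simp
      then show ?thesis using PM[OF x] len x y N
        by (simp add: nth_append kmul_assoc[symmetric] kmul_scale_left)
    qed
    fix L assume L: "kernel_on ?W L" and LP: "\<forall>k<Suc n. kmul ?W L (P k) = kmul ?W (P k) L"
    have "kmul ?W L (N y) = kmul ?W (M x) (kmul ?W L (E s))"
      unfolding N kmul_assoc[symmetric] using commM[OF L _ x] LP by simp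
    also have "\<dots> = kmul ?W (N y) L"
      unfolding N kmul_assoc using commE[OF L _ s] LP by simp
    finally show "kmul ?W L (N y) = kmul ?W (N y) L" .
  qed
  then show ?case by blast
qed

section \<open>Symmetrised operators on words\<close>

definition words :: "nat \<Rightarrow> nat \<Rightarrow> (nat \<Rightarrow> nat) set" where
  "words n d = PiE {..<n} (\<lambda>_. {..<d})"

lemma finite_words [simp]: "finite (words n d)"
  by (simp add: words_def finite_PiE)

lemma words_lt: "w \<in> words n d \<Longrightarrow> i < n \<Longrightarrow> w i < d"
  unfolding words_def by auto

lemma words_upd: "w \<in> words n d \<Longrightarrow> i < n \<Longrightarrow> a < d \<Longrightarrow> w(i := a) \<in> words n d"
  unfolding words_def by (auto simp: PiE_def extensional_def)

lemma words_comp: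
  assumes "w \<in> words n d" "p permutes {..<n}"
  shows "w \<circ> p \<in> words n d"
proof -
  have "p i < n \<longleftrightarrow> i < n" for i using permutes_in_image[OF assms(2), of i] by simp
  then show ?thesis using assms permutes_not_in[OF assms(2)]
    unfolding words_def by (auto simp: PiE_def extensional_def Pi_iff)
qed

text \<open>The kernel of \<open>O\<^sub>i U\<^sub>p\<close>, where \<open>(U\<^sub>p f) w = f (w \<circ> p)\<close> on functions of words and \<open>O\<^sub>i\<close> is \<open>A\<close> acting
  on the \<open>i\<close>-th letter; \<open>perm_op2\<close> below is \<open>O\<^sub>i O\<^sub>j U\<^sub>p\<close>.\<close>

definition perm_op :: "nat \<Rightarrow> (nat \<Rightarrow> nat \<Rightarrow> complex) \<Rightarrow> nat \<Rightarrow> (nat \<Rightarrow> nat) \<Rightarrow> (nat \<Rightarrow> nat) \<Rightarrow> (nat \<Rightarrow> nat) \<Rightarrow> complex" where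
  "perm_op d A i p w x = (\<Sum>a<d. A (w i) a * of_bool (x = w(i := a) \<circ> p))"

definition perm_op2 :: "nat \<Rightarrow> (nat \<Rightarrow> nat \<Rightarrow> complex) \<Rightarrow> nat \<Rightarrow> nat \<Rightarrow> (nat \<Rightarrow> nat) \<Rightarrow> (nat \<Rightarrow> nat) \<Rightarrow> (nat \<Rightarrow> nat) \<Rightarrow> complex" where
  "perm_op2 d A i j p w x =
     (\<Sum>a<d. \<Sum>b<d. A (w i) a * A ((w(i := a)) j) b * of_bool (x = w(i := a, j := b) \<circ> p))"

lemma perm_op_apply:
  assumes w: "w \<in> words n d" and i: "i < n" and p: "p permutes {..<n}"
  shows "(\<Sum>x\<in>words n d. perm_op d A i p w x * f x) = (\<Sum>a<d. A (w i) a * f (w(i := a) \<circ> p))"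
proof -
  have "(\<Sum>x\<in>words n d. perm_op d A i p w x * f x) =
      (\<Sum>a<d. \<Sum>x\<in>words n d. A (w i) a * of_bool (x = w(i := a) \<circ> p) * f x)"
    unfolding perm_op_def sum_distrib_right by (rule sum.swap)
  also have "\<dots> = (\<Sum>a<d. A (w i) a * f (w(i := a) \<circ> p))"
  proof (intro sum.cong refl)
    fix a assume "a \<in> {..<d}"
    then have y: "w(i := a) \<circ> p \<in> words n d" using w i p by (intro words_comp words_upd) auto
    have "(\<Sum>x\<in>words n d. A (w i) a * of_bool (x = w(i := a) \<circ> p) * f x) =
        (\<Sum>x\<in>words n d. if x = w(i := a) \<circ> p then A (w i) a * f x else 0)"
      by (intro sum.cong) auto
    then show "(\<Sum>x\<in>words n d. A (w i) a * of_bool (x = w(i := a) \<circ> p) * f x) =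
        A (w i) a * f (w(i := a) \<circ> p)" using y by simp
  qed
  finally show ?thesis .
qed

text \<open>Moving \<open>U\<^sub>p\<close> past an observable relocates it from position
  \<open>j\<close> to \<open>p j\<close>, and \<open>U\<^sub>p U\<^sub>q\<close> belongs to
  \<open>p \<circ> q\<close>. Hence a product of two such operators is again one permutation
  operator, with two marks.\<close>

lemma perm_op_mult:
  assumes w: "w \<in> words n d" and i: "i < n" and p: "p permutes {..<n}"
  shows "kmul (words n d) (perm_op d A i p) (perm_op d A j q) w x = perm_op2 d A i (p j) (p \<circ> q) w x"
proof -
  have upd: "(u \<circ> p)(j := b) \<circ> q = u(p j := b) \<circ> (p \<circ> q)" for u :: "nat \<Rightarrow> nat" and b
    using permutes_inj[OF p] by (auto simp: fun_eq_iff inj_eq)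
  have "kmul (words n d) (perm_op d A i p) (perm_op d A j q) w x =
      (\<Sum>a<d. A (w i) a * perm_op d A j q (w(i := a) \<circ> p) x)"
    unfolding kmul_def by (rule perm_op_apply[OF w i p])
  also have "\<dots> = perm_op2 d A i (p j) (p \<circ> q) w x"
    unfolding perm_op_def perm_op2_def upd sum_distrib_left by (simp add: mult.assoc)
  finally show ?thesis .
qed

text \<open>Both marks carry the same \<open>A\<close>, so they form an unordered pair: a reflection
  that exchanges them is as good as one that fixes them.\<close>

lemma perm_op2_commute: "perm_op2 d A i j p w x = perm_op2 d A j i p w x"
proof (cases "i = j")
  case False
  have "perm_op2 d A i j p w x =
      (\<Sum>b<d. \<Sum>a<d. A (w i) a * A ((w(i := a)) j) b * of_bool (x = w(i := a, j := b) \<circ> p))"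
    unfolding perm_op2_def by (rule sum.swap)
  then show ?thesis unfolding perm_op2_def using False
    by (simp add: fun_upd_twist[OF False] mult_ac)
qed simp

text \<open>At most one letter \<open>a\<close> solves \<open>x = w(i := a) \<circ> p\<close>, so
  the sum collapses. In this form \<open>w\<close> and \<open>x\<close> can be exchanged, as the
  adjoint demands.\<close>

lemma perm_op_closed:
  assumes x: "x \<in> words n d" and i: "i < n" and p: "p permutes {..<n}"
  shows "perm_op d A i p w x =
    (if \<forall>t. t \<noteq> i \<longrightarrow> w t = x (inv p t) then A (w i) (x (inv p i)) else 0)"
proof -
  have lt: "x (inv p i) < d"
    using words_lt[OF words_comp[OF x permutes_inv[OF p]] i] by simp
  have "x = w(i := a) \<circ> p \<longleftrightarrow> x \<circ> inv p = w(i := a)" for a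
    using permutes_inv_o[OF p] by (metis comp_assoc comp_id)
  then have eq: "x = w(i := a) \<circ> p \<longleftrightarrow> a = x (inv p i) \<and> (\<forall>t. t \<noteq> i \<longrightarrow> w t = x (inv p t))" for a
    by (auto simp: fun_eq_iff)
  have "perm_op d A i p w x = (\<Sum>a<d. if a = x (inv p i) then
      (if \<forall>t. t \<noteq> i \<longrightarrow> w t = x (inv p t) then A (w i) a else 0) else 0)"
    unfolding perm_op_def eq by (intro sum.cong) auto
  then show ?thesis using lt by simp
qed

text \<open>The adjoint of \<open>O\<^sub>i U\<^sub>p\<close> has the observable to the right of the
  inverse permutation; bringing it to the front relocates its mark by \<open>inv p\<close>.\<close>

lemma perm_op_adj:
  assumes w: "w \<in> words n d" and x: "x \<in> words n d" and i: "i < n" and p: "p permutes {..<n}"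
    and herm: "kadj A = A"
  shows "cnj (perm_op d A i p x w) = perm_op d A (inv p i) (inv p) w x"
proof -
  have i': "inv p i < n" using permutes_in_image[OF permutes_inv[OF p], of i] i by simp
  have ip: "inv p (p t) = t" "p (inv p t) = t" "inv (inv p) = p" for t
    using permutes_inverses[OF p] permutes_inv_inv[OF p] by auto
  have "(\<forall>t. t \<noteq> i \<longrightarrow> x t = w (inv p t)) \<longleftrightarrow> (\<forall>t. t \<noteq> inv p i \<longrightarrow> w t = x (p t))"
    by (metis ip(1,2))
  moreover have "cnj (A (x i) (w (inv p i))) = A (w (inv p i)) (x i)"
    using fun_cong[OF fun_cong[OF herm], of "w (inv p i)" "x i"] by (simp add: kadj_def)
  ultimately show ?thesis
    unfolding perm_op_closed[OF w i p] perm_op_closed[OF x i' permutes_inv[OF p]] by (auto simp: ip)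
qed

lemma perm_op2_adj:
  assumes w: "w \<in> words n d" and x: "x \<in> words n d" and i: "i < n" and j: "j < n"
    and p: "p permutes {..<n}" and herm: "kadj A = A"
  shows "cnj (perm_op2 d A i j p x w) = perm_op2 d A (inv p i) (inv p j) (inv p) w x"
proof -
  have j': "inv p j < n" using permutes_in_image[OF permutes_inv[OF p], of j] j by simp
  \<comment> \<open>The identity permutation separates the two marks into two factors, each with a
    single mark.\<close>
  have "cnj (perm_op2 d A i j p x w) =
      cnj (kmul (words n d) (perm_op d A i id) (perm_op d A j p) x w)"
    using perm_op_mult[OF x i permutes_id] by simp
  also have "\<dots> = (\<Sum>y\<in>words n d. cnj (perm_op d A j p y w) * cnj (perm_op d A i id x y))"
    by (simp add: kmul_def mult.commute)
  also have "\<dots> = (\<Sum>y\<in>words n d. perm_op d A (inv p j) (inv p) w y * perm_op d A i id y x)"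
    using perm_op_adj[OF w _ j p herm] perm_op_adj[OF _ x i permutes_id herm]
    by (intro sum.cong) auto
  also have "\<dots> = perm_op2 d A (inv p j) (inv p i) (inv p) w x"
    using perm_op_mult[OF w j' permutes_inv[OF p], of A i id] by (simp add: kmul_def)
  finally show ?thesis by (subst perm_op2_commute)
qed

section \<open>Averages over all conjugations\<close>

definition sym_op2 where
  "sym_op2 n d A i j p w x =
     (\<Sum>s | s permutes {..<n}. perm_op2 d A (s i) (s j) (s \<circ> p \<circ> inv s) w x)"

definition sym_op where
  "sym_op n d A i p w x = (\<Sum>s | s permutes {..<n}. perm_op d A (s i) (s \<circ> p \<circ> inv s) w x)"

lemma conj_inv:
  assumes "p permutes S" "s permutes S"
  shows "inv (s \<circ> p \<circ> inv s) = s \<circ> inv p \<circ> inv s" "inv (s \<circ> p \<circ> inv s) (s i) = s (inv p i)"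
proof -
  have b: "bij p" "bij s" "bij (inv s)"
    using assms permutes_bij permutes_inv by blast+
  show "inv (s \<circ> p \<circ> inv s) = s \<circ> inv p \<circ> inv s"
    using b by (simp add: o_inv_distrib bij_comp inv_inv_eq comp_assoc)
  then show "inv (s \<circ> p \<circ> inv s) (s i) = s (inv p i)"
    using permutes_inverses[OF assms(2)] by simp
qed

lemma conj_comp:
  assumes "t permutes S" "s permutes S"
  shows "(s \<circ> t) \<circ> p \<circ> inv (s \<circ> t) = s \<circ> (t \<circ> p \<circ> inv t) \<circ> inv s"
  using permutes_bij[OF assms(1)] permutes_bij[OF assms(2)]
  by (simp add: o_inv_distrib comp_assoc)

lemma conj_permutes: "p permutes S \<Longrightarrow> s permutes S \<Longrightarrow> s \<circ> p \<circ> inv s permutes S"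
  by (intro permutes_compose permutes_inv)

text \<open>The adjoint of \<open>O\<^sub>i O\<^sub>j U\<^sub>p\<close> is conjugate, by \<open>U\<^sub>p\<close>, to \<open>O\<^sub>i O\<^sub>j U\<^sub>q\<close> with \<open>q\<close> the inverse of \<open>p\<close>;
  since \<open>p\<close> is conjugate to its inverse by a permutation preserving the set of the two marked
  positions, averaging over all conjugations makes the operator Hermitian.\<close>

lemma sym_op2_hermitian:
  assumes w: "w \<in> words n d" and x: "x \<in> words n d" and i: "i < n" and j: "j < n"
    and p: "p permutes {..<n}" and herm: "kadj A = A"
  shows "cnj (sym_op2 n d A i j p x w) = sym_op2 n d A i j p w x"
proof -
  let ?F = "\<lambda>s i j p. perm_op2 d A (s i) (s j) (s \<circ> p \<circ> inv s) w x"
  have lt: "s i < n" if "s permutes {..<n}" "i < n" for s i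
    using permutes_in_image[OF that(1), of i] that(2) by simp
  have ip: "inv p permutes {..<n}" using p by (rule permutes_inv)
  obtain q where q: "q permutes {..<n}" "q \<circ> inv p \<circ> inv q = p"
    and qij: "q i = i \<and> q j = j \<or> q i = j \<and> q j = i"
    using permutes_inverted_by_involution[OF ip finite_lessThan, of i j] permutes_inv_inv[OF p] by metis
  have "cnj (sym_op2 n d A i j p x w) = (\<Sum>s | s permutes {..<n}. ?F s (inv p i) (inv p j) (inv p))"
    unfolding sym_op2_def cnj_sum
    using perm_op2_adj[OF w x lt[OF _ i] lt[OF _ j] conj_permutes[OF p] herm]
    by (intro sum.cong refl) (simp add: conj_inv[OF p])
  also have "\<dots> = (\<Sum>s | s permutes {..<n}. ?F (s \<circ> p) (inv p i) (inv p j) (inv p))"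
    by (rule sum_permutations_compose_right[OF p])
  also have "\<dots> = (\<Sum>s | s permutes {..<n}. ?F s i j (inv p))"
    using permutes_inverses[OF p] permutes_inv_o[OF p]
    by (intro sum.cong refl) (simp add: conj_comp[OF p])
  also have "\<dots> = (\<Sum>s | s permutes {..<n}. ?F (s \<circ> q) i j (inv p))"
    by (rule sum_permutations_compose_right[OF q(1)])
  also have "\<dots> = (\<Sum>s | s permutes {..<n}. ?F s i j p)"
    using qij perm_op2_commute
    by (intro sum.cong refl) (auto simp: conj_comp[OF q(1)] q(2))
  finally show ?thesis unfolding sym_op2_def .
qed

lemma sym_op_hermitian:
  assumes w: "w \<in> words n d" and x: "x \<in> words n d" and i: "i < n"
    and p: "p permutes {..<n}" and herm: "kadj A = A"
  shows "cnj (sym_op n d A i p x w) = sym_op n d A i p w x"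
proof -
  let ?F = "\<lambda>s i p. perm_op d A (s i) (s \<circ> p \<circ> inv s) w x"
  have lt: "s i < n" if "s permutes {..<n}" "i < n" for s i
    using permutes_in_image[OF that(1), of i] that(2) by simp
  have ip: "inv p permutes {..<n}" using p by (rule permutes_inv)
  \<comment> \<open>With both marks equal to \<open>i\<close>, the two alternatives coincide and the
    involution fixes \<open>i\<close>.\<close>
  obtain q where q: "q permutes {..<n}" "q \<circ> inv p \<circ> inv q = p" and qi: "q i = i"
    using permutes_inverted_by_involution[OF ip finite_lessThan, of i i] permutes_inv_inv[OF p] by metis
  have "cnj (sym_op n d A i p x w) = (\<Sum>s | s permutes {..<n}. ?F s (inv p i) (inv p))"
    unfolding sym_op_def cnj_sum
    using perm_op_adj[OF w x lt[OF _ i] conj_permutes[OF p] herm]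
    by (intro sum.cong refl) (simp add: conj_inv[OF p])
  also have "\<dots> = (\<Sum>s | s permutes {..<n}. ?F (s \<circ> p) (inv p i) (inv p))"
    by (rule sum_permutations_compose_right[OF p])
  also have "\<dots> = (\<Sum>s | s permutes {..<n}. ?F s i (inv p))"
    using permutes_inverses[OF p] permutes_inv_o[OF p]
    by (intro sum.cong refl) (simp add: conj_comp[OF p])
  also have "\<dots> = (\<Sum>s | s permutes {..<n}. ?F (s \<circ> q) i (inv p))"
    by (rule sum_permutations_compose_right[OF q(1)])
  also have "\<dots> = (\<Sum>s | s permutes {..<n}. ?F s i p)"
    by (intro sum.cong refl) (simp add: conj_comp[OF q(1)] q(2) qi)
  finally show ?thesis unfolding sym_op_def .
qed

text \<open>In the double sum over the two conjugations \<open>s\<close> and \<open>t\<close>,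
  replacing \<open>s\<close> by \<open>t \<circ> s\<close> turns the summand into the conjugate by
  \<open>t\<close> of an operator in which only \<open>s\<close> occurs. The sum over
  \<open>t\<close> is then a \<open>sym_op2\<close>, whose Hermiticity passes to the product;
  \<open>s\<close> is the summation variable that the statement calls \<open>t\<close>.\<close>

lemma sym_op_mult:
  assumes w: "w \<in> words n d" and i: "i < n" and p: "p permutes {..<n}"
  shows "kmul (words n d) (sym_op n d A i p) (sym_op n d A j q) w x =
    (\<Sum>t | t permutes {..<n}. sym_op2 n d A (t i) ((t \<circ> p \<circ> inv t) j) (t \<circ> p \<circ> inv t \<circ> q) w x)"
proof -
  let ?S = "{s. s permutes {..<n}}"
  let ?c = "\<lambda>s p. s \<circ> p \<circ> inv s"
  have lt: "s i < n" if "s permutes {..<n}" for s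
    using permutes_in_image[OF that(1), of i] i by simp
  have "kmul (words n d) (sym_op n d A i p) (sym_op n d A j q) w x =
      (\<Sum>s\<in>?S. \<Sum>t\<in>?S. kmul (words n d) (perm_op d A (s i) (?c s p)) (perm_op d A (t j) (?c t q)) w x)"
    unfolding sym_op_def[abs_def] kmul_sum_left kmul_sum_right by (simp add: kmul_sum_right)
  also have "\<dots> = (\<Sum>s\<in>?S. \<Sum>t\<in>?S. perm_op2 d A (s i) (?c s p (t j)) (?c s p \<circ> ?c t q) w x)"
    using perm_op_mult[OF w lt conj_permutes[OF p]] by (intro sum.cong refl) simp
  also have "\<dots> = (\<Sum>t\<in>?S. \<Sum>s\<in>?S. perm_op2 d A (s i) (?c s p (t j)) (?c s p \<circ> ?c t q) w x)"
    by (rule sum.swap)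
  also have "\<dots> = (\<Sum>t\<in>?S. \<Sum>s\<in>?S. perm_op2 d A (t (s i)) (t (?c s p j)) (?c t (?c s p \<circ> q)) w x)"
  proof (rule sum.cong[OF refl])
    fix t assume "t \<in> ?S"
    then have t: "t permutes {..<n}" by simp
    have "(\<Sum>s\<in>?S. perm_op2 d A (s i) (?c s p (t j)) (?c s p \<circ> ?c t q) w x) =
      (\<Sum>s\<in>?S. perm_op2 d A ((t \<circ> s) i) (?c (t \<circ> s) p (t j)) (?c (t \<circ> s) p \<circ> ?c t q) w x)"
      by (rule setum_permutations_compose_left[OF t])
    also have "\<dots> = (\<Sum>s\<in>?S. perm_op2 d A (t (s i)) (t (?c s p j)) (?c t (?c s p \<circ> q)) w x)"
    proof (rule sum.cong[OF refl])
      fix s assume "s \<in> ?S"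
      then have s: "s permutes {..<n}" by simp
      have "?c (t \<circ> s) p \<circ> ?c t q = ?c t (?c s p \<circ> q)"
        unfolding conj_comp[OF s t] using permutes_inverses[OF t] by (simp add: fun_eq_iff)
      moreover have "?c (t \<circ> s) p (t j) = t (?c s p j)"
        unfolding conj_comp[OF s t] using permutes_inverses[OF t] by simp
      ultimately show "perm_op2 d A ((t \<circ> s) i) (?c (t \<circ> s) p (t j)) (?c (t \<circ> s) p \<circ> ?c t q) w x =
          perm_op2 d A (t (s i)) (t (?c s p j)) (?c t (?c s p \<circ> q)) w x" by simp
    qed
    finally show "(\<Sum>s\<in>?S. perm_op2 d A (s i) (?c s p (t j)) (?c s p \<circ> ?c t q) w x) =
      (\<Sum>s\<in>?S. perm_op2 d A (t (s i)) (t (?c s p j)) (?c t (?c s p \<circ> q)) w x)" .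
  qed
  also have "\<dots> = (\<Sum>s\<in>?S. \<Sum>t\<in>?S. perm_op2 d A (t (s i)) (t (?c s p j)) (?c t (?c s p \<circ> q)) w x)"
    by (rule sum.swap)
  finally show ?thesis unfolding sym_op2_def .
qed

lemma sym_op_commute:
  assumes w: "w \<in> words n d" and x: "x \<in> words n d" and i: "i < n" and j: "j < n"
    and p: "p permutes {..<n}" and q: "q permutes {..<n}" and herm: "kadj A = A"
  shows "kmul (words n d) (sym_op n d A i p) (sym_op n d A j q) w x =
    kmul (words n d) (sym_op n d A j q) (sym_op n d A i p) w x"
proof -
  have lt: "s i < n" if "s permutes {..<n}" "i < n" for s i
    using permutes_in_image[OF that(1), of i] that(2) by simp
  have "kmul (words n d) (sym_op n d A i p) (sym_op n d A j q) w x =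
      cnj (kmul (words n d) (sym_op n d A i p) (sym_op n d A j q) x w)"
    unfolding sym_op_mult[OF w i p] sym_op_mult[OF x i p] cnj_sum
  proof (intro sum.cong refl sym_op2_hermitian[symmetric] w x herm)
    fix t assume "t \<in> {t. t permutes {..<n}}"
    then have t: "t permutes {..<n}" by simp
    show "t i < n" using lt t i by blast
    show "(t \<circ> p \<circ> inv t) j < n" by (rule lt[OF conj_permutes[OF p t] j])
    show "t \<circ> p \<circ> inv t \<circ> q permutes {..<n}" using conj_permutes[OF p t] q by (rule permutes_compose[rotated])
  qed
  also have "\<dots> = kmul (words n d) (sym_op n d A j q) (sym_op n d A i p) w x"
    unfolding kmul_def cnj_sum complex_cnj_mult
    using sym_op_hermitian[OF w _ j q herm] sym_op_hermitian[OF _ x i p herm]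
    by (intro sum.cong refl) (simp add: mult.commute)
  finally show ?thesis .
qed

section \<open>Expectations in a product state\<close>

definition tensor_kernel :: "nat \<Rightarrow> (nat \<Rightarrow> nat \<Rightarrow> complex) \<Rightarrow> (nat \<Rightarrow> nat) \<Rightarrow> (nat \<Rightarrow> nat) \<Rightarrow> complex" where
  "tensor_kernel n r v w = (\<Prod>t<n. r (v t) (w t))"

text \<open>\<open>tr (K R)\<close> for the \<open>n\<close>-fold tensor power \<open>R\<close> of
  \<open>r\<close>.\<close>

definition expct :: "nat \<Rightarrow> nat \<Rightarrow> (nat \<Rightarrow> nat \<Rightarrow> complex) \<Rightarrow> ((nat \<Rightarrow> nat) \<Rightarrow> (nat \<Rightarrow> nat) \<Rightarrow> complex) \<Rightarrow> complex" where
  "expct n d r K = (\<Sum>w\<in>words n d. \<Sum>v\<in>words n d. K w v * tensor_kernel n r v w)"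

text \<open>The trace of a permutation operator times one-site matrices \<open>Y s\<close>, as a sum
  over labellings of the positions. The set \<open>S\<close> is a parameter so that the trace can be
  factored over the cycles of \<open>p\<close>.\<close>

definition perm_trace :: "nat \<Rightarrow> nat set \<Rightarrow> (nat \<Rightarrow> nat \<Rightarrow> nat \<Rightarrow> complex) \<Rightarrow> (nat \<Rightarrow> nat) \<Rightarrow> complex" where
  "perm_trace d S Y p = (\<Sum>w\<in>PiE S (\<lambda>_. {..<d}). \<Prod>s\<in>S. Y s (w s) (w (p s)))"

lemma sum_PiE_insert:
  assumes "x \<notin> S"
  shows "(\<Sum>w\<in>PiE (insert x S) (\<lambda>_. A). f w) = (\<Sum>u\<in>PiE S (\<lambda>_. A). \<Sum>a\<in>A. f (u(x := a)))"
proof -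
  have inj: "inj_on (\<lambda>(a, u). u(x := a)) (A \<times> PiE S (\<lambda>_. A))"
    using assms by (rule inj_combinator)
  have "(\<Sum>w\<in>PiE (insert x S) (\<lambda>_. A). f w) = (\<Sum>(a, u)\<in>A \<times> PiE S (\<lambda>_. A). f (u(x := a)))"
    unfolding PiE_insert_eq by (subst sum.reindex[OF inj]) (simp add: case_prod_beta)
  also have "\<dots> = (\<Sum>a\<in>A. \<Sum>u\<in>PiE S (\<lambda>_. A). f (u(x := a)))" by (simp add: sum.cartesian_product)
  also have "\<dots> = (\<Sum>u\<in>PiE S (\<lambda>_. A). \<Sum>a\<in>A. f (u(x := a)))" by (rule sum.swap)
  finally show ?thesis .
qed

lemma perm_trace_union:
  assumes fin: "finite S" "finite T" and disj: "S \<inter> T = {}" and p: "p ` S \<subseteq> S" "p ` T \<subseteq> T"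
  shows "perm_trace d (S \<union> T) Y p = perm_trace d S Y p * perm_trace d T Y p"
proof -
  let ?D = "\<lambda>_::nat. {..<d}"
  define F where "F S w = (\<Prod>s\<in>S. Y s (w s) (w (p s)))" for S and w :: "nat \<Rightarrow> nat"
  let ?m = "\<lambda>(u, v). \<lambda>s. if s \<in> S then u s else v s :: nat"
  let ?r = "\<lambda>w. (restrict w S, restrict w T)"
  have "perm_trace d (S \<union> T) Y p = (\<Sum>w\<in>PiE (S \<union> T) ?D. F S w * F T w)"
    unfolding perm_trace_def F_def using fin disj by (simp add: prod.union_disjoint)
  also have "\<dots> = (\<Sum>(u, v)\<in>PiE S ?D \<times> PiE T ?D. F S u * F T v)"
  proof (rule sum.reindex_bij_witness[where i = ?m and j = ?r])
    fix w assume w: "w \<in> PiE (S \<union> T) ?D"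
    show "?m (?r w) = w" using w by (auto simp: fun_eq_iff PiE_def extensional_def)
    show "?r w \<in> PiE S ?D \<times> PiE T ?D" using w by auto
    have "F S (restrict w S) = F S w" "F T (restrict w T) = F T w"
      unfolding F_def using p by (auto intro!: prod.cong)
    then show "(case ?r w of (u, v) \<Rightarrow> F S u * F T v) = F S w * F T w" by simp
  next
    fix z assume z: "z \<in> PiE S ?D \<times> PiE T ?D"
    then show "?r (?m z) = z" using disj
      by (auto simp: fun_eq_iff PiE_def extensional_def restrict_def)
    show "?m z \<in> PiE (S \<union> T) ?D" using z by (auto simp: PiE_def extensional_def Pi_iff split: if_splits)
  qed
  also have "\<dots> = perm_trace d S Y p * perm_trace d T Y p"
    unfolding perm_trace_def F_def[symmetric] by (simp add: sum_product sum.cartesian_product)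
  finally show ?thesis .
qed

fun kpow :: "nat \<Rightarrow> (nat \<Rightarrow> nat \<Rightarrow> complex) \<Rightarrow> nat \<Rightarrow> nat \<Rightarrow> nat \<Rightarrow> complex" where
  "kpow d r 0 a b = of_bool (a = b)"
| "kpow d r (Suc m) a b = (\<Sum>c<d. kpow d r m a c * r c b)"

text \<open>An entry of a matrix power is a sum over paths. The weight \<open>g\<close> of the end
  points is arbitrary so that the induction can absorb the last edge into it.\<close>

lemma sum_paths:
  "(\<Sum>u\<in>PiE {..<Suc m} (\<lambda>_. {..<d}). (\<Prod>t<m. r (u t) (u (Suc t))) * g (u 0) (u m)) =
    (\<Sum>a<d. \<Sum>b<d. kpow d r m a b * g a b)"
proof (induction m arbitrary: g)
  case 0
  have "(\<Sum>b<d. of_bool (a = b) * g a b) = g a a" if "a < d" for a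
  proof -
    have "(\<Sum>b<d. of_bool (a = b) * g a b) = (\<Sum>b<d. if a = b then g a b else 0)"
      by (intro sum.cong) auto
    then show ?thesis using that by simp
  qed
  then show ?case using sum_PiE_insert[of 0 "{}" "\<lambda>u. g (u 0) (u 0)" "{..<d}"]
    by (simp add: lessThan_Suc)
next
  case (Suc m)
  have "(\<Sum>u\<in>PiE {..<Suc (Suc m)} (\<lambda>_. {..<d}). (\<Prod>t<Suc m. r (u t) (u (Suc t))) * g (u 0) (u (Suc m))) =
    (\<Sum>u\<in>PiE {..<Suc m} (\<lambda>_. {..<d}). \<Sum>c<d.
       ((\<Prod>t<m. r (u t) (u (Suc t))) * r (u m) c) * g (u 0) c)"
    unfolding lessThan_Suc[of "Suc m"] by (subst sum_PiE_insert) (auto intro!: sum.cong prod.cong)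
  also have "\<dots> = (\<Sum>u\<in>PiE {..<Suc m} (\<lambda>_. {..<d}).
       (\<Prod>t<m. r (u t) (u (Suc t))) * (\<Sum>c<d. r (u m) c * g (u 0) c))"
    by (simp add: sum_distrib_left mult.assoc)
  also have "\<dots> = (\<Sum>a<d. \<Sum>b<d. kpow d r m a b * (\<Sum>c<d. r b c * g a c))"
    by (rule Suc.IH)
  also have "\<dots> = (\<Sum>a<d. \<Sum>b<d. \<Sum>c<d. kpow d r m a b * r b c * g a c)"
    by (simp add: sum_distrib_left mult.assoc)
  also have "\<dots> = (\<Sum>a<d. \<Sum>c<d. \<Sum>b<d. kpow d r m a b * r b c * g a c)"
    by (intro sum.cong refl sum.swap)
  also have "\<dots> = (\<Sum>a<d. \<Sum>c<d. kpow d r (Suc m) a c * g a c)"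
    by (simp add: sum_distrib_right)
  finally show ?case .
qed

text \<open>\<open>h\<close> lists one cycle in the order in which \<open>p\<close> visits it, the
  marked position last. The labellings are closed paths, and their sum is the trace of
  \<open>r\<close> to the power \<open>m\<close> times \<open>B\<close>.\<close>

lemma perm_trace_cycle:
  assumes inj: "inj_on h {..<Suc m}" and step: "\<And>t. t < m \<Longrightarrow> p (h t) = h (Suc t)"
    and close: "p (h m) = h 0" and Yr: "\<And>t. t < m \<Longrightarrow> Y (h t) = r" and YB: "Y (h m) = B"
  shows "perm_trace d (h ` {..<Suc m}) Y p = (\<Sum>a<d. \<Sum>b<d. kpow d r m a b * B b a)"
proof -
  let ?S = "h ` {..<Suc m}" and ?D = "\<lambda>_::nat. {..<d}"
  define h' where "h' = inv_into {..<Suc m} h"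
  have h'h: "h' (h t) = t" if "t < Suc m" for t unfolding h'_def using inv_into_f_f[OF inj] that by simp
  have "perm_trace d ?S Y p = (\<Sum>u\<in>PiE {..<Suc m} ?D. (\<Prod>t<m. r (u t) (u (Suc t))) * B (u m) (u 0))"
    unfolding perm_trace_def
  proof (rule sum.reindex_bij_witness[where i = "\<lambda>u. restrict (u \<circ> h') ?S"
        and j = "\<lambda>w. restrict (w \<circ> h) {..<Suc m}"])
    fix w assume w: "w \<in> PiE ?S ?D"
    show "restrict (restrict (w \<circ> h) {..<Suc m} \<circ> h') ?S = w"
      using w h'h by (fastforce simp: fun_eq_iff PiE_def extensional_def restrict_def)
    show "restrict (w \<circ> h) {..<Suc m} \<in> PiE {..<Suc m} ?D" using w by auto
    have "(\<Prod>s\<in>?S. Y s (w s) (w (p s))) = (\<Prod>t<Suc m. Y (h t) (w (h t)) (w (p (h t))))"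
      using inj by (simp add: prod.reindex)
    also have "\<dots> = (\<Prod>t<m. r (w (h t)) (w (h (Suc t)))) * B (w (h m)) (w (h 0))"
      using step close Yr YB by simp
    finally show "(\<Prod>t<m. r (restrict (w \<circ> h) {..<Suc m} t) (restrict (w \<circ> h) {..<Suc m} (Suc t))) *
      B (restrict (w \<circ> h) {..<Suc m} m) (restrict (w \<circ> h) {..<Suc m} 0) = (\<Prod>s\<in>?S. Y s (w s) (w (p s)))"
      by simp
  next
    fix u assume u: "u \<in> PiE {..<Suc m} ?D"
    show "restrict (restrict (u \<circ> h') ?S \<circ> h) {..<Suc m} = u"
      using u h'h by (auto simp: fun_eq_iff PiE_def extensional_def restrict_def)
    show "restrict (u \<circ> h') ?S \<in> PiE ?S ?D" using u h'h by auto
  qed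
  then show ?thesis using sum_paths[where g = "\<lambda>a b. B b a"] by simp
qed

lemma perm_trace_id:
  assumes "\<And>s. s \<in> S \<Longrightarrow> p s = s" "\<And>s. s \<in> S \<Longrightarrow> Y s = r" "(\<Sum>a<d. r a a) = 1" "finite S"
  shows "perm_trace d S Y p = 1"
proof -
  have "perm_trace d S Y p = (\<Sum>w\<in>PiE S (\<lambda>_. {..<d}). \<Prod>s\<in>S. r (w s) (w s))"
    unfolding perm_trace_def using assms by (intro sum.cong prod.cong) auto
  also have "\<dots> = (\<Prod>s\<in>S. \<Sum>a<d. r a a)" using assms(4) by (subst prod_sum_PiE) auto
  finally show ?thesis using assms(3) by simp
qed

lemma tensor_kernel_comp:
  assumes p: "p permutes {..<n}"
  shows "tensor_kernel n r (u \<circ> p) w = (\<Prod>s<n. r (u s) (w (inv p s)))"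
proof -
  have "tensor_kernel n r (u \<circ> p) w = (\<Prod>t<n. (\<lambda>s. r (u s) (w (inv p s))) (p t))"
    unfolding tensor_kernel_def using permutes_inverses[OF p] by simp
  also have "\<dots> = (\<Prod>s<n. r (u s) (w (inv p s)))"
    using prod.permute[OF p, of "\<lambda>s. r (u s) (w (inv p s))"] by (simp add: comp_def)
  finally show ?thesis .
qed

text \<open>The operator replaces \<open>v\<close> by \<open>w(i := a) \<circ> p\<close>, and
  reindexing the product moves \<open>p\<close> to the other argument as \<open>inv p\<close>. The
  sum over \<open>a\<close> turns the factor at \<open>i\<close> into the product of
  \<open>A\<close> and \<open>r\<close>.\<close>

lemma expct_perm_op:
  assumes i: "i < n" and p: "p permutes {..<n}"
  shows "expct n d r (perm_op d A i p) =
    perm_trace d {..<n} ((\<lambda>_. r)(i := kmul {..<d} A r)) (inv p)"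
proof -
  let ?Y = "(\<lambda>_. r)(i := kmul {..<d} A r)"
  have "(\<Sum>v\<in>words n d. perm_op d A i p w v * tensor_kernel n r v w) =
      (\<Prod>s<n. ?Y s (w s) (w (inv p s)))" if w: "w \<in> words n d" for w
  proof -
    have "(\<Sum>v\<in>words n d. perm_op d A i p w v * tensor_kernel n r v w) =
      (\<Sum>a<d. A (w i) a * (\<Prod>s<n. r ((w(i := a)) s) (w (inv p s))))"
      unfolding perm_op_apply[OF w i p] tensor_kernel_comp[OF p] ..
    also have "\<dots> = (\<Sum>a<d. A (w i) a * r a (w (inv p i)) * (\<Prod>s\<in>{..<n}-{i}. r (w s) (w (inv p s))))"
      using i by (intro sum.cong refl) (simp add: prod.remove[of _ i])
    also have "\<dots> = (\<Prod>s<n. ?Y s (w s) (w (inv p s)))"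
      using i by (simp add: prod.remove[of _ i] kmul_def sum_distrib_right)
    finally show ?thesis .
  qed
  then show ?thesis unfolding expct_def perm_trace_def words_def by simp
qed

lemma perm_op2_apply:
  assumes w: "w \<in> words n d" and i: "i < n" and j: "j < n" and p: "p permutes {..<n}"
  shows "(\<Sum>x\<in>words n d. perm_op2 d A i j p w x * f x) =
    (\<Sum>a<d. \<Sum>b<d. A (w i) a * A ((w(i := a)) j) b * f (w(i := a, j := b) \<circ> p))"
proof -
  have "(\<Sum>x\<in>words n d. perm_op2 d A i j p w x * f x) =
    (\<Sum>x\<in>words n d. \<Sum>y\<in>words n d. perm_op d A i id w y * (perm_op d A j p y x * f x))"
    using perm_op_mult[OF w i permutes_id, of A j p, symmetric]
    by (simp add: kmul_def sum_distrib_right mult.assoc)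
  also have "\<dots> = (\<Sum>y\<in>words n d. \<Sum>x\<in>words n d. perm_op d A i id w y * (perm_op d A j p y x * f x))"
    by (rule sum.swap)
  also have "\<dots> = (\<Sum>y\<in>words n d. perm_op d A i id w y * (\<Sum>a<d. A (y j) a * f (y(j := a) \<circ> p)))"
    using perm_op_apply[OF _ j p] by (simp add: sum_distrib_left[symmetric])
  also have "\<dots> = (\<Sum>a<d. A (w i) a * (\<Sum>b<d. A ((w(i := a)) j) b * f (w(i := a, j := b) \<circ> p)))"
    unfolding perm_op_apply[OF w i permutes_id] by simp
  finally show ?thesis by (simp add: sum_distrib_left mult.assoc)
qed

lemma expct_perm_op2:
  assumes i: "i < n" and j: "j < n" and ij: "i \<noteq> j" and p: "p permutes {..<n}"
  shows "expct n d r (perm_op2 d A i j p) =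
    perm_trace d {..<n} ((\<lambda>_. r)(i := kmul {..<d} A r, j := kmul {..<d} A r)) (inv p)"
proof -
  let ?Y = "(\<lambda>_. r)(i := kmul {..<d} A r, j := kmul {..<d} A r)"
  have "(\<Sum>v\<in>words n d. perm_op2 d A i j p w v * tensor_kernel n r v w) =
      (\<Prod>s<n. ?Y s (w s) (w (inv p s)))" if w: "w \<in> words n d" for w
  proof -
    let ?R = "\<Prod>s\<in>{..<n}-{i}-{j}. r (w s) (w (inv p s))"
    have rem: "(\<Prod>s<n. f s) = f i * (f j * (\<Prod>s\<in>{..<n}-{i}-{j}. f s))" for f :: "nat \<Rightarrow> complex"
      using i j ij by (simp add: prod.remove[of _ i] prod.remove[of "{..<n} - {i}" j])
    have "(\<Sum>v\<in>words n d. perm_op2 d A i j p w v * tensor_kernel n r v w) =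
      (\<Sum>a<d. \<Sum>b<d. A (w i) a * A (w j) b * (\<Prod>s<n. r ((w(i := a, j := b)) s) (w (inv p s))))"
      unfolding perm_op2_apply[OF w i j p] tensor_kernel_comp[OF p] using ij by simp
    also have "\<dots> = (\<Sum>a<d. \<Sum>b<d. (A (w i) a * r a (w (inv p i))) * (A (w j) b * r b (w (inv p j)) * ?R))"
      unfolding rem using ij by (simp add: mult_ac)
    also have "\<dots> = (\<Sum>a<d. A (w i) a * r a (w (inv p i))) * ((\<Sum>b<d. A (w j) b * r b (w (inv p j))) * ?R)"
      by (simp only: sum_distrib_right[of _ _ ?R] sum_product)
    also have "\<dots> = (\<Prod>s<n. ?Y s (w s) (w (inv p s)))"
      unfolding rem using ij by (simp add: kmul_def)
    finally show ?thesis .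
  qed
  then show ?thesis unfolding expct_def perm_trace_def words_def by simp
qed

lemma perm_op2_same: "perm_op2 d A i i p = perm_op d (kmul {..<d} A A) i p"
proof (intro ext)
  fix w x
  have "perm_op2 d A i i p w x = (\<Sum>b<d. \<Sum>a<d. A (w i) a * A a b * of_bool (x = w(i := b) \<circ> p))"
    unfolding perm_op2_def by (subst sum.swap) simp
  then show "perm_op2 d A i i p w x = perm_op d (kmul {..<d} A A) i p w x"
    by (simp add: perm_op_def kmul_def sum_distrib_right)
qed

section \<open>Conjugates of the cycle on the first k positions\<close>

definition cyc :: "nat \<Rightarrow> nat \<Rightarrow> nat" where
  "cyc k t = (if t < k then Suc t mod k else t)"

lemma cyc_permutes:
  assumes "k \<le> n"
  shows "cyc k permutes {..<n}"
proof (rule bij_imp_permutes)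
  define g where "g t = (if t < k then (if t = 0 then k - 1 else t - 1) else t)" for t
  have 1: "g (cyc k t) = t" for t by (cases "Suc t = k") (auto simp: cyc_def g_def)
  have 2: "cyc k (g t) = t" for t by (auto simp: cyc_def g_def)
  have 3: "cyc k t < n" if "t < n" for t
    using that assms by (auto simp: cyc_def intro: less_le_trans[OF mod_less_divisor])
  have 4: "g t < n" if "t < n" for t using that assms by (auto simp: g_def)
  show "bij_betw (cyc k) {..<n} {..<n}"
    by (rule bij_betw_byWitness[where f' = g]) (use 1 2 3 4 in auto)
  show "cyc k x = x" if "x \<notin> {..<n}" for x using that assms by (auto simp: cyc_def)
qed

lemma conj_cyc_step:
  assumes s: "s permutes {..<n}"
  shows "Suc t < k \<Longrightarrow> (s \<circ> cyc k \<circ> inv s) (s t) = s (Suc t)"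
    "0 < k \<Longrightarrow> (s \<circ> cyc k \<circ> inv s) (s (k - 1)) = s 0"
    "u \<notin> s ` {..<k} \<Longrightarrow> (s \<circ> cyc k \<circ> inv s) u = u"
proof -
  show "Suc t < k \<Longrightarrow> (s \<circ> cyc k \<circ> inv s) (s t) = s (Suc t)"
    "0 < k \<Longrightarrow> (s \<circ> cyc k \<circ> inv s) (s (k - 1)) = s 0"
    using permutes_inverses[OF s] by (auto simp: cyc_def)
  assume u: "u \<notin> s ` {..<k}"
  have "\<not> inv s u < k" using u permutes_inverses(1)[OF s, of u] by (metis imageI lessThan_iff)
  then show "(s \<circ> cyc k \<circ> inv s) u = u" using permutes_inverses[OF s] by (simp add: cyc_def)
qed

lemma inv_conj_cyc_step:
  assumes s: "s permutes {..<n}" and k: "0 < k" "k \<le> n"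
  shows "Suc t < k \<Longrightarrow> inv (s \<circ> cyc k \<circ> inv s) (s (Suc t)) = s t"
    "inv (s \<circ> cyc k \<circ> inv s) (s 0) = s (k - 1)"
    "u \<notin> s ` {..<k} \<Longrightarrow> inv (s \<circ> cyc k \<circ> inv s) u = u"
  using conj_cyc_step[OF s] permutes_inv_eq[OF conj_permutes[OF cyc_permutes[OF k(2)] s]] k
  by metis+

definition cyc_op :: "nat \<Rightarrow> (nat \<Rightarrow> nat \<Rightarrow> complex) \<Rightarrow> nat \<Rightarrow> (nat \<Rightarrow> nat) \<Rightarrow> (nat \<Rightarrow> nat) \<Rightarrow> (nat \<Rightarrow> nat) \<Rightarrow> complex" where
  "cyc_op d A k s = perm_op d A (s 0) (s \<circ> cyc k \<circ> inv s)"

text \<open>The trace of \<open>r\<close> to the power \<open>k - 1\<close> times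
  \<open>A r\<close>, the form in which a walk around the cycle delivers it.\<close>

definition cyc_mean :: "nat \<Rightarrow> (nat \<Rightarrow> nat \<Rightarrow> complex) \<Rightarrow> (nat \<Rightarrow> nat \<Rightarrow> complex) \<Rightarrow> nat \<Rightarrow> complex" where
  "cyc_mean d A r k = (\<Sum>a<d. \<Sum>b<d. kpow d r (k - 1) a b * kmul {..<d} A r b a)"

text \<open>The inverse cycle runs backwards from \<open>s (k - 1)\<close> to \<open>s 0\<close>, so
  the marked position \<open>s 0\<close> comes last, as \<open>perm_trace_cycle\<close> requires.
  Only the action of \<open>p\<close> on this block is prescribed, so that the lemma also applies
  inside a product of two cycles.\<close>

lemma perm_trace_inv_cyc:
  assumes s: "s permutes {..<n}" and k: "0 < k" "k \<le> n"
    and p: "\<And>u. u \<in> s ` {..<k} \<Longrightarrow> p u = inv (s \<circ> cyc k \<circ> inv s) u"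
    and Y: "\<And>t. 0 < t \<Longrightarrow> t < k \<Longrightarrow> Y (s t) = r" "Y (s 0) = kmul {..<d} A r"
  shows "perm_trace d (s ` {..<k}) Y p = cyc_mean d A r k"
proof -
  let ?h = "\<lambda>t. s (k - 1 - t)"
  obtain m where m: "k = Suc m" using k by (cases k) auto
  have "s ` {..<k} = ?h ` {..<Suc m}"
  proof -
    have "x \<in> (\<lambda>t. k - 1 - t) ` {..<Suc m}" if "x < k" for x
      using that m by (intro image_eqI[of _ _ "k - 1 - x"]) auto
    then have img: "{..<k} = (\<lambda>t. k - 1 - t) ` {..<Suc m}" using m by auto
    show ?thesis by (subst img) (simp only: image_image)
  qed
  moreover have "perm_trace d (?h ` {..<Suc m}) Y p =
      (\<Sum>a<d. \<Sum>b<d. kpow d r m a b * kmul {..<d} A r b a)"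
  proof (rule perm_trace_cycle)
    show "inj_on ?h {..<Suc m}"
    proof (rule inj_onI)
      fix x y assume xy: "x \<in> {..<Suc m}" "y \<in> {..<Suc m}" "?h x = ?h y"
      have "k - 1 - x = k - 1 - y" using permutes_inj[OF s] xy(3) by (rule injD)
      then show "x = y" using xy(1,2) m by simp
    qed
    show "p (?h t) = ?h (Suc t)" if "t < m" for t
    proof -
      have 1: "Suc (k - 1 - Suc t) = k - 1 - t" "k - 1 - t < k" using that m by auto
      then have "?h t \<in> s ` {..<k}" by blast
      then have "p (?h t) = inv (s \<circ> cyc k \<circ> inv s) (s (Suc (k - 1 - Suc t)))" using p 1 by simp
      also have "\<dots> = ?h (Suc t)" using 1 by (intro inv_conj_cyc_step(1)[OF s k]) simp
      finally show ?thesis .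
    qed
    have "?h m = s 0" "s 0 \<in> s ` {..<k}" using m by auto
    then show "p (?h m) = ?h 0" using inv_conj_cyc_step(2)[OF s k] p[of "s 0"] by simp
    show "Y (?h t) = r" if "t < m" for t using Y(1) that m by auto
    show "Y (?h m) = kmul {..<d} A r" using Y(2) m by simp
  qed
  ultimately show ?thesis by (simp add: cyc_mean_def m)
qed

text \<open>The counterpart for an adjoint factor, whose cycle is traversed forwards and whose mark
  has moved to \<open>s (k - 1)\<close>.\<close>

lemma perm_trace_cyc:
  assumes s: "s permutes {..<n}" and k: "0 < k" "k \<le> n"
    and p: "\<And>u. u \<in> s ` {..<k} \<Longrightarrow> p u = (s \<circ> cyc k \<circ> inv s) u"
    and Y: "\<And>t. t < k - 1 \<Longrightarrow> Y (s t) = r" "Y (s (k - 1)) = kmul {..<d} A r"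
  shows "perm_trace d (s ` {..<k}) Y p = cyc_mean d A r k"
proof -
  obtain m where m: "k = Suc m" using k by (cases k) auto
  have "perm_trace d (s ` {..<Suc m}) Y p = (\<Sum>a<d. \<Sum>b<d. kpow d r m a b * kmul {..<d} A r b a)"
  proof (rule perm_trace_cycle)
    show "inj_on s {..<Suc m}" using permutes_inj[OF s] by (rule inj_on_subset) simp
    show "p (s t) = s (Suc t)" if "t < m" for t
      using p[of "s t"] conj_cyc_step(1)[OF s, of t k] that m by (metis Suc_mono imageI lessThan_iff less_SucI)
    show "p (s m) = s 0"
      using p[of "s m"] conj_cyc_step(2)[OF s k(1)] m by (metis diff_Suc_1 imageI lessI lessThan_iff)
  qed (use Y m in auto)
  then show ?thesis by (simp add: cyc_mean_def m)
qed

text \<open>The block of the cycle contributes the trace of a matrix product, and each remaining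
  position is fixed and contributes the trace of \<open>r\<close>, which is 1.\<close>

lemma expct_cyc_op:
  assumes s: "s permutes {..<n}" and k: "0 < k" "k \<le> n" and tr: "(\<Sum>a<d. r a a) = 1"
  shows "expct n d r (cyc_op d A k s) = cyc_mean d A r k"
proof -
  let ?c = "s \<circ> cyc k \<circ> inv s" and ?S = "s ` {..<k}"
  let ?Y = "(\<lambda>_. r)(s 0 := kmul {..<d} A r)"
  have S: "?S \<subseteq> {..<n}" using k permutes_image[OF s] by fastforce
  have c: "?c permutes {..<n}" by (rule conj_permutes[OF cyc_permutes[OF k(2)] s])
  have s0: "s 0 < n" using S k by auto
  have out: "inv ?c u = u" if "u \<notin> ?S" for u by (rule inv_conj_cyc_step(3)[OF s k that])
  have inS: "inv ?c u \<in> ?S" if "u \<in> ?S" for u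
    using out[of "inv ?c u"] that permutes_inverses(1)[OF c, of u] conj_cyc_step(3)[OF s, of "inv ?c u" k]
    by metis
  have "expct n d r (cyc_op d A k s) = perm_trace d {..<n} ?Y (inv ?c)"
    unfolding cyc_op_def by (rule expct_perm_op[OF s0 c])
  also have "{..<n} = ?S \<union> ({..<n} - ?S)" using S by blast
  also have "perm_trace d (?S \<union> ({..<n} - ?S)) ?Y (inv ?c) =
      perm_trace d ?S ?Y (inv ?c) * perm_trace d ({..<n} - ?S) ?Y (inv ?c)"
    using inS out by (intro perm_trace_union) auto
  also have "perm_trace d ({..<n} - ?S) ?Y (inv ?c) = 1"
    using out tr k by (intro perm_trace_id[where r = r]) auto
  also have "perm_trace d ?S ?Y (inv ?c) = cyc_mean d A r k"
    using permutes_inj[OF s] by (intro perm_trace_inv_cyc[OF s k]) (auto simp: inj_eq)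
  finally show ?thesis by simp
qed

lemma expct_cong:
  assumes "\<And>w v. w \<in> words n d \<Longrightarrow> v \<in> words n d \<Longrightarrow> K w v = L w v"
  shows "expct n d r K = expct n d r L"
  unfolding expct_def using assms by (intro sum.cong) auto

text \<open>The adjoint moves the mark of the second factor back along its cycle, from
  \<open>t 0\<close> to \<open>t (k - 1)\<close>; the first permutation then relocates it.\<close>

lemma cyc_op_gram:
  assumes w: "w \<in> words n d" and x: "x \<in> words n d" and s: "s permutes {..<n}" and t: "t permutes {..<n}"
    and k: "0 < k" "k \<le> n" and herm: "kadj A = A"
  shows "kmul (words n d) (cyc_op d A k s) (kadj (cyc_op d A k t)) w x =
    perm_op2 d A (s 0) ((s \<circ> cyc k \<circ> inv s) (t (k - 1))) ((s \<circ> cyc k \<circ> inv s) \<circ> inv (t \<circ> cyc k \<circ> inv t)) w x"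
proof -
  let ?c = "\<lambda>s. s \<circ> cyc k \<circ> inv s"
  have lt: "s 0 < n" "t 0 < n" using permutes_in_image[OF s, of 0] permutes_in_image[OF t, of 0] k by auto
  have c: "?c s permutes {..<n}" "?c t permutes {..<n}"
    using conj_permutes[OF cyc_permutes[OF k(2)]] s t by auto
  have "kmul (words n d) (cyc_op d A k s) (kadj (cyc_op d A k t)) w x =
    kmul (words n d) (perm_op d A (s 0) (?c s)) (perm_op d A (t (k - 1)) (inv (?c t))) w x"
    unfolding kmul_def cyc_op_def kadj_def
    using perm_op_adj[OF _ x lt(2) c(2) herm] inv_conj_cyc_step(2)[OF t k] by (intro sum.cong refl) simp
  then show ?thesis using perm_op_mult[OF w lt(1) c(1)] by simp
qed

text \<open>The permutations cancel and the mark at \<open>s (k - 1)\<close> returns to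
  \<open>s 0\<close>, which leaves the square of the observable at one position, whatever
  \<open>k\<close> is.\<close>

lemma expct_cyc_op_same:
  assumes s: "s permutes {..<n}" and k: "0 < k" "k \<le> n" and herm: "kadj A = A"
    and tr: "(\<Sum>a<d. r a a) = 1"
  shows "expct n d r (kmul (words n d) (cyc_op d A k s) (kadj (cyc_op d A k s))) =
    (\<Sum>a<d. kmul {..<d} (kmul {..<d} A A) r a a)"
proof -
  let ?c = "s \<circ> cyc k \<circ> inv s" and ?AA = "kmul {..<d} A A"
  let ?Y = "(\<lambda>_. r)(s 0 := kmul {..<d} ?AA r)"
  have c: "?c permutes {..<n}" by (rule conj_permutes[OF cyc_permutes[OF k(2)] s])
  have s0: "s 0 < n" using permutes_in_image[OF s, of 0] k by auto
  have "expct n d r (kmul (words n d) (cyc_op d A k s) (kadj (cyc_op d A k s))) =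
      expct n d r (perm_op d ?AA (s 0) id)"
    using cyc_op_gram[OF _ _ s s k herm] conj_cyc_step(2)[OF s k(1)] permutes_inv_o(1)[OF c]
    by (intro expct_cong) (simp add: perm_op2_same)
  also have "\<dots> = perm_trace d {..<n} ?Y (inv id)" by (rule expct_perm_op[OF s0 permutes_id])
  also have "\<dots> = perm_trace d ({s 0} \<union> ({..<n} - {s 0})) ?Y id"
    using s0 by (simp add: insert_absorb)
  also have "\<dots> = perm_trace d {s 0} ?Y id * perm_trace d ({..<n} - {s 0}) ?Y id"
    by (intro perm_trace_union) auto
  also have "perm_trace d ({..<n} - {s 0}) ?Y id = 1" using tr by (intro perm_trace_id[where r = r]) auto
  also have "perm_trace d {s 0} ?Y id = (\<Sum>a<d. kmul {..<d} ?AA r a a)"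
    unfolding perm_trace_def using sum_PiE_insert[of "s 0" "{}" "\<lambda>w. kmul {..<d} ?AA r (w (s 0)) (w (s 0))" "{..<d}"]
    by simp
  finally show ?thesis by simp
qed

text \<open>Cycles on disjoint blocks do not interact: the trace has one factor for each block and 1
  for the rest. In terms of covariance, the blocks are uncorrelated.\<close>

lemma expct_cyc_op_disjoint:
  assumes s: "s permutes {..<n}" and t: "t permutes {..<n}" and k: "0 < k" "k \<le> n" and herm: "kadj A = A"
    and tr: "(\<Sum>a<d. r a a) = 1" and disj: "s ` {..<k} \<inter> t ` {..<k} = {}"
  shows "expct n d r (kmul (words n d) (cyc_op d A k s) (kadj (cyc_op d A k t))) = (cyc_mean d A r k)\<^sup>2"
proof -
  define c e where c_def: "c = s \<circ> cyc k \<circ> inv s" and e_def: "e = t \<circ> cyc k \<circ> inv t"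
  note c_step = conj_cyc_step[OF s, where k = k, folded c_def] and c_inv = inv_conj_cyc_step[OF s k, folded c_def]
    and e_step = conj_cyc_step[OF t, where k = k, folded e_def] and e_inv = inv_conj_cyc_step[OF t k, folded e_def]
  let ?S = "s ` {..<k}" and ?T = "t ` {..<k}"
  let ?p = "inv (c \<circ> inv e)"
  let ?Y = "(\<lambda>_. r)(s 0 := kmul {..<d} A r, t (k - 1) := kmul {..<d} A r)"
  have c: "c permutes {..<n}" and e: "e permutes {..<n}"
    unfolding c_def e_def using conj_permutes[OF cyc_permutes[OF k(2)]] s t by auto
  have ST: "?S \<subseteq> {..<n}" "?T \<subseteq> {..<n}" using k permutes_image[OF s] permutes_image[OF t] by fastforce+
  have mem: "s 0 \<in> ?S" "t (k - 1) \<in> ?T" using k by auto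
  then have ne: "s 0 \<noteq> t (k - 1)" using disj by (metis disjoint_iff)
  \<comment> \<open>\<open>?p\<close> runs backwards on the block of \<open>s\<close> and forwards
    on the block of \<open>t\<close>; hence the two versions of the cycle trace.\<close>
  have pp: "?p u = e (inv c u)" for u
    using o_inv_distrib[OF permutes_bij[OF c] permutes_bij[OF permutes_inv[OF e]]]
    by (simp add: permutes_inv_inv[OF e])
  have out: "inv c u = u" if "u \<notin> ?S" for u by (rule c_inv(3)[OF that])
  have inS: "inv c u \<in> ?S" if "u \<in> ?S" for u
    using out[of "inv c u"] that permutes_inverses(1)[OF c, of u] c_step(3)[of "inv c u"]
    by metis
  have out': "e u = u" if "u \<notin> ?T" for u by (rule e_step(3)[OF that])
  have inT: "e u \<in> ?T" if "u \<in> ?T" for u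
    using out'[of "e u"] that permutes_inverses(2)[OF e, of u] e_inv(3)[of "e u"]
    by metis
  have pS: "?p u = inv c u" if "u \<in> ?S" for u using inS[OF that] disj out'[of "inv c u"] pp[of u] by auto
  have pT: "?p u = e u" if "u \<in> ?T" for u
  proof -
    have "u \<notin> ?S" using that disj by blast
    then show ?thesis using out pp by metis
  qed
  have pid: "?p u = u" if "u \<notin> ?S" "u \<notin> ?T" for u
    using out[OF that(1)] out'[OF that(2)] pp[of u] by metis
  let ?R = "{..<n} - ?S - ?T"
  have "?p ` ?S \<subseteq> ?S" using pS inS by (metis image_subsetI)
  moreover have pT_sub: "?p ` ?T \<subseteq> ?T" using pT inT by (metis image_subsetI)
  moreover have pR_sub: "?p ` ?R \<subseteq> ?R" using pid by (metis DiffE image_subsetI)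
  ultimately have pS_sub: "?p ` ?S \<subseteq> ?S" "?p ` (?T \<union> ?R) \<subseteq> ?T \<union> ?R"
    unfolding image_Un by blast+
  have "expct n d r (kmul (words n d) (cyc_op d A k s) (kadj (cyc_op d A k t))) =
      expct n d r (perm_op2 d A (s 0) (t (k - 1)) (c \<circ> inv e))"
  proof (rule expct_cong)
    fix w v assume wv: "w \<in> words n d" "v \<in> words n d"
    have "c (t (k - 1)) = t (k - 1)" using mem disj by (intro c_step(3)) auto
    then show "kmul (words n d) (cyc_op d A k s) (kadj (cyc_op d A k t)) w v =
        perm_op2 d A (s 0) (t (k - 1)) (c \<circ> inv e) w v"
      using cyc_op_gram[OF wv s t k herm, folded c_def e_def] by metis
  qed
  also have "\<dots> = perm_trace d {..<n} ?Y ?p"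
    using mem ST ne by (intro expct_perm_op2 permutes_compose[OF permutes_inv[OF e] c]) auto
  also have "{..<n} = ?S \<union> (?T \<union> ({..<n} - ?S - ?T))" using ST by blast
  also have "perm_trace d (?S \<union> (?T \<union> ({..<n} - ?S - ?T))) ?Y ?p =
      perm_trace d ?S ?Y ?p * perm_trace d (?T \<union> ({..<n} - ?S - ?T)) ?Y ?p"
    using disj by (intro perm_trace_union pS_sub) auto
  also have "perm_trace d (?T \<union> ({..<n} - ?S - ?T)) ?Y ?p =
      perm_trace d ?T ?Y ?p * perm_trace d ({..<n} - ?S - ?T) ?Y ?p"
    by (intro perm_trace_union pT_sub pR_sub) auto
  also have "perm_trace d ({..<n} - ?S - ?T) ?Y ?p = 1"
    using mem pid tr by (intro perm_trace_id[where r = r]) auto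
  also have "perm_trace d ?S ?Y ?p = cyc_mean d A r k"
  proof (rule perm_trace_inv_cyc[OF s k])
    show "?p u = inv (s \<circ> cyc k \<circ> inv s) u" if "u \<in> ?S" for u using pS[OF that] unfolding c_def .
    show "?Y (s i) = r" if "0 < i" "i < k" for i
    proof -
      have "s i \<noteq> s 0" using permutes_inj[OF s] that by (simp add: inj_eq)
      moreover have "s i \<noteq> t (k - 1)"
      proof -
        have "s i \<in> ?S" using that by simp
        then show ?thesis using mem(2) disj by (metis disjoint_iff)
      qed
      ultimately show ?thesis by simp
    qed
    show "?Y (s 0) = kmul {..<d} A r" using ne by simp
  qed
  also have "perm_trace d ?T ?Y ?p = cyc_mean d A r k"
  proof (rule perm_trace_cyc[OF t k])
    show "?p u = (t \<circ> cyc k \<circ> inv t) u" if "u \<in> ?T" for u using pT[OF that] unfolding e_def .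
    show "?Y (t i) = r" if "i < k - 1" for i
    proof -
      have "t i \<noteq> t (k - 1)" using permutes_inj[OF t] that by (simp add: inj_eq)
      moreover have "t i \<noteq> s 0"
      proof -
        have "t i \<in> ?T" using that by simp
        then show ?thesis using mem(1) disj by (metis disjoint_iff)
      qed
      ultimately show ?thesis by simp
    qed
    show "?Y (t (k - 1)) = kmul {..<d} A r" by simp
  qed
  finally show ?thesis by (simp add: power2_eq_square)
qed

section \<open>The second moment of the estimators\<close>

text \<open>For a factorisation \<open>r = G G\<^sup>*\<close> of the state, \<open>amp K\<close> is the adjoint of \<open>K\<close> applied to the tensor
  power of \<open>G\<close> (entrywise conjugated), so that \<open>tr (K L\<^sup>* r)\<close> on the copies becomes an inner product.\<close>

definition amp :: "nat \<Rightarrow> nat \<Rightarrow> (nat \<Rightarrow> 'c \<Rightarrow> complex) \<Rightarrow> ((nat \<Rightarrow> nat) \<Rightarrow> (nat \<Rightarrow> nat) \<Rightarrow> complex) \<Rightarrow>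
    (nat \<Rightarrow> nat) \<Rightarrow> (nat \<Rightarrow> 'c) \<Rightarrow> complex" where
  "amp n d G K x c = (\<Sum>w\<in>words n d. K w x * cnj (\<Prod>t<n. G (w t) (c t)))"

definition amp_inner where
  "amp_inner n d C G K L =
    (\<Sum>x\<in>words n d. \<Sum>c\<in>PiE {..<n} (\<lambda>_. C). amp n d G K x c * cnj (amp n d G L x c))"

lemma sum_swap4:
  "(\<Sum>x\<in>X. \<Sum>c\<in>C. \<Sum>w\<in>W. \<Sum>v\<in>V. f x c w v) = (\<Sum>w\<in>W. \<Sum>v\<in>V. \<Sum>x\<in>X. \<Sum>c\<in>C. f x c w v)"
proof -
  have "(\<Sum>x\<in>X. \<Sum>c\<in>C. \<Sum>w\<in>W. \<Sum>v\<in>V. f x c w v) = (\<Sum>x\<in>X. \<Sum>w\<in>W. \<Sum>v\<in>V. \<Sum>c\<in>C. f x c w v)"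
    by (subst sum.swap, intro sum.cong refl sum.swap)
  also have "\<dots> = (\<Sum>w\<in>W. \<Sum>v\<in>V. \<Sum>x\<in>X. \<Sum>c\<in>C. f x c w v)"
    by (subst sum.swap, intro sum.cong refl sum.swap)
  finally show ?thesis .
qed

lemma expct_gram:
  assumes C: "finite C"
    and r: "\<And>a b. a < d \<Longrightarrow> b < d \<Longrightarrow> r a b = (\<Sum>c\<in>C. G a c * cnj (G b c))"
  shows "expct n d r (kmul (words n d) K (kadj L)) = amp_inner n d C G K L"
proof -
  let ?W = "words n d" and ?C = "PiE {..<n} (\<lambda>_. C)"
  let ?g = "\<lambda>w c. \<Prod>t<n. G (w t) (c t)"
  have R: "tensor_kernel n r v w = (\<Sum>c\<in>?C. ?g v c * cnj (?g w c))" if "v \<in> ?W" "w \<in> ?W" for v w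
  proof -
    have "tensor_kernel n r v w = (\<Prod>t<n. \<Sum>c\<in>C. G (v t) c * cnj (G (w t) c))"
      unfolding tensor_kernel_def using r words_lt that by (intro prod.cong) auto
    also have "\<dots> = (\<Sum>c\<in>?C. \<Prod>t<n. G (v t) (c t) * cnj (G (w t) (c t)))"
      by (rule prod_sum_PiE) (use C in auto)
    finally show ?thesis by (simp add: prod.distrib)
  qed
  have "amp_inner n d C G K L = (\<Sum>x\<in>?W. \<Sum>c\<in>?C. \<Sum>w\<in>?W. \<Sum>v\<in>?W.
      (K w x * cnj (L v x)) * (?g v c * cnj (?g w c)))"
    unfolding amp_inner_def amp_def cnj_sum sum_product by (simp add: mult_ac)
  also have "\<dots> = (\<Sum>w\<in>?W. \<Sum>v\<in>?W. \<Sum>x\<in>?W. \<Sum>c\<in>?C. (K w x * cnj (L v x)) * (?g v c * cnj (?g w c)))"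
    by (rule sum_swap4)
  also have "\<dots> = (\<Sum>w\<in>?W. \<Sum>v\<in>?W. kmul ?W K (kadj L) w v * tensor_kernel n r v w)"
    unfolding kmul_def kadj_def by (intro sum.cong refl) (simp add: R sum_product)
  finally show ?thesis unfolding expct_def by simp
qed

lemma amp_scaled_sum: "amp n d G (\<lambda>w x. (\<Sum>i\<in>I. F i w x) / z) y c = (\<Sum>i\<in>I. amp n d G (F i) y c) / z"
proof -
  have "amp n d G (\<lambda>w x. (\<Sum>i\<in>I. F i w x) / z) y c =
      (\<Sum>w\<in>words n d. \<Sum>i\<in>I. F i w y * cnj (\<Prod>t<n. G (w t) (c t)) / z)"
    unfolding amp_def by (simp add: sum_divide_distrib sum_distrib_right)
  also have "\<dots> = (\<Sum>i\<in>I. \<Sum>w\<in>words n d. F i w y * cnj (\<Prod>t<n. G (w t) (c t)) / z)"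
    by (rule sum.swap)
  finally show ?thesis unfolding amp_def by (simp add: sum_divide_distrib)
qed

lemma amp_inner_self:
  "Re (amp_inner n d C G K K) = (\<Sum>x\<in>words n d. \<Sum>c\<in>PiE {..<n} (\<lambda>_. C). (cmod (amp n d G K x c))\<^sup>2)"
  unfolding amp_inner_def by (simp add: complex_mult_cnj cmod_power2)

lemma amp_inner_scaled_sums:
  "amp_inner n d C G (\<lambda>w x. (\<Sum>i\<in>I. F i w x) / of_real z) (\<lambda>w x. (\<Sum>i\<in>I. F i w x) / of_real z) =
    (\<Sum>i\<in>I. \<Sum>j\<in>I. amp_inner n d C G (F i) (F j)) / of_real (z\<^sup>2)"
proof -
  have "amp_inner n d C G (\<lambda>w x. (\<Sum>i\<in>I. F i w x) / of_real z) (\<lambda>w x. (\<Sum>i\<in>I. F i w x) / of_real z) =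
    (\<Sum>x\<in>words n d. \<Sum>c\<in>PiE {..<n} (\<lambda>_. C). \<Sum>i\<in>I. \<Sum>j\<in>I.
      amp n d G (F i) x c * cnj (amp n d G (F j) x c)) / of_real (z\<^sup>2)"
    unfolding amp_inner_def amp_scaled_sum
    by (simp add: sum_product power2_eq_square sum_divide_distrib)
  also have "(\<Sum>x\<in>words n d. \<Sum>c\<in>PiE {..<n} (\<lambda>_. C). \<Sum>i\<in>I. \<Sum>j\<in>I.
      amp n d G (F i) x c * cnj (amp n d G (F j) x c)) = (\<Sum>i\<in>I. \<Sum>j\<in>I. amp_inner n d C G (F i) (F j))"
    unfolding amp_inner_def by (rule sum_swap4)
  finally show ?thesis .
qed

lemma cmod_mean_squared_le:
  assumes "finite S" "S \<noteq> {}"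
  shows "(cmod ((\<Sum>s\<in>S. z s) / of_nat (card S)))\<^sup>2 \<le> (\<Sum>s\<in>S. (cmod (z s))\<^sup>2) / card S"
proof -
  have N: "real (card S) > 0" using assms by (simp add: card_gt_0_iff)
  have "(cmod (\<Sum>s\<in>S. z s))\<^sup>2 \<le> (\<Sum>s\<in>S. cmod (z s))\<^sup>2"
    by (intro power_mono norm_sum) simp
  also have "\<dots> \<le> (\<Sum>s\<in>S. (cmod (z s))\<^sup>2) * card S"
  proof -
    \<comment> \<open>The mean of the moduli; the squared deviations from it have a nonnegative sum,
      which is the Cauchy-Schwarz bound.\<close>
    define a where "a = (\<Sum>s\<in>S. cmod (z s)) / card S"
    have a: "(\<Sum>s\<in>S. cmod (z s)) = card S * a" using N by (simp add: a_def)
    have "0 \<le> (\<Sum>s\<in>S. (cmod (z s) - a)\<^sup>2)" by (intro sum_nonneg) simp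
    also have "\<dots> = (\<Sum>s\<in>S. (cmod (z s))\<^sup>2) - 2 * a * (\<Sum>s\<in>S. cmod (z s)) + card S * a\<^sup>2"
      by (simp add: power2_diff sum.distrib sum_subtractf sum_distrib_left mult_ac)
    finally have "card S * a\<^sup>2 \<le> (\<Sum>s\<in>S. (cmod (z s))\<^sup>2)" unfolding a by (simp add: power2_eq_square mult_ac)
    then have "card S * (card S * a\<^sup>2) \<le> card S * (\<Sum>s\<in>S. (cmod (z s))\<^sup>2)"
      by (rule mult_left_mono) simp
    then show ?thesis unfolding a by (simp add: power2_eq_square mult_ac)
  qed
  finally show ?thesis using N by (simp add: norm_divide power_divide field_simps power2_eq_square)
qed

text \<open>\<open>amp\<close> is linear in the operator and the second moment is the sum of the
  squared moduli of its values, so convexity of the square applies value by value. This covers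
  operators that cannot be measured jointly.\<close>

lemma amp_inner_mean_le:
  assumes S: "finite S" "S \<noteq> {}"
  shows "Re (amp_inner n d C G (\<lambda>w x. (\<Sum>s\<in>S. F s w x) / of_nat (card S)) (\<lambda>w x. (\<Sum>s\<in>S. F s w x) / of_nat (card S)))
    \<le> (\<Sum>s\<in>S. Re (amp_inner n d C G (F s) (F s))) / card S"
proof -
  have "Re (amp_inner n d C G (\<lambda>w x. (\<Sum>s\<in>S. F s w x) / of_nat (card S)) (\<lambda>w x. (\<Sum>s\<in>S. F s w x) / of_nat (card S)))
    \<le> (\<Sum>x\<in>words n d. \<Sum>c\<in>PiE {..<n} (\<lambda>_. C). (\<Sum>s\<in>S. (cmod (amp n d G (F s) x c))\<^sup>2) / card S)"
    unfolding amp_inner_self amp_scaled_sum by (intro sum_mono cmod_mean_squared_le S)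
  also have "\<dots> = (\<Sum>x\<in>words n d. \<Sum>c\<in>PiE {..<n} (\<lambda>_. C). \<Sum>s\<in>S. (cmod (amp n d G (F s) x c))\<^sup>2) / card S"
    by (simp add: sum_divide_distrib)
  also have "(\<Sum>x\<in>words n d. \<Sum>c\<in>PiE {..<n} (\<lambda>_. C). \<Sum>s\<in>S. (cmod (amp n d G (F s) x c))\<^sup>2) =
      (\<Sum>x\<in>words n d. \<Sum>s\<in>S. \<Sum>c\<in>PiE {..<n} (\<lambda>_. C). (cmod (amp n d G (F s) x c))\<^sup>2)"
    by (intro sum.cong refl sum.swap)
  also have "\<dots> = (\<Sum>s\<in>S. Re (amp_inner n d C G (F s) (F s)))"
    unfolding amp_inner_self by (rule sum.swap)
  finally show ?thesis .
qed

section \<open>The estimators and their block averages\<close>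

definition estimator :: "nat \<Rightarrow> nat \<Rightarrow> (nat \<Rightarrow> nat \<Rightarrow> complex) \<Rightarrow> nat \<Rightarrow> (nat \<Rightarrow> nat) \<Rightarrow> (nat \<Rightarrow> nat) \<Rightarrow> complex" where
  "estimator n d A k w x = sym_op n d A 0 (cyc k) w x / of_nat (fact n)"

text \<open>Composing a permutation with this exchange of the blocks \<open>0\<close> and
  \<open>b\<close> moves its cycle to the image of the \<open>b\<close>-th block. For
  \<open>b = 0\<close> it is the identity.\<close>

definition block_swap :: "nat \<Rightarrow> nat \<Rightarrow> nat \<Rightarrow> nat" where
  "block_swap k b t = (if t < k then t + b * k else if b * k \<le> t \<and> t < b * k + k then t - b * k else t)"

lemma block_swap_permutes:
  assumes "b * k + k \<le> n"
  shows "block_swap k b permutes {..<n}"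
proof (rule bij_imp_permutes)
  have inv: "block_swap k b (block_swap k b t) = t" for t
    by (cases b) (auto simp: block_swap_def)
  have "block_swap k b t < n" if "t < n" for t using that assms by (auto simp: block_swap_def)
  then show "bij_betw (block_swap k b) {..<n} {..<n}"
    by (intro bij_betw_byWitness[where f' = "block_swap k b"]) (auto simp: inv)
  show "block_swap k b x = x" if "x \<notin> {..<n}" for x
    using that assms by (auto simp: block_swap_def)
qed

lemma block_swap_image_disjoint:
  assumes "b \<noteq> c"
  shows "block_swap k b ` {..<k} \<inter> block_swap k c ` {..<k} = {}"
proof -
  have "block_swap k b t div k = b" if "t < k" for b t
    using that by (simp add: block_swap_def)
  then show ?thesis using assms by (metis (no_types, lifting) disjoint_iff imageE lessThan_iff)
qed

lemma cyc_op_sum_shift: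
  assumes "p permutes {..<n}"
  shows "(\<Sum>s | s permutes {..<n}. cyc_op d A k (s \<circ> p) w x) = (\<Sum>s | s permutes {..<n}. cyc_op d A k s w x)"
  using sum_permutations_compose_right[OF assms, of "\<lambda>s. cyc_op d A k s w x"] by simp

text \<open>Averaging the \<open>m\<close> disjoint \<open>k\<close>-blocks of positions first, as in Hoeffding's treatment of
  U-statistics: the block averages have independent summands, and averaging them over all
  permutations can only decrease the second moment.\<close>

lemma estimator_second_moment_le:
  assumes k: "0 < k" "k \<le> n" and herm: "kadj A = A" and tr: "(\<Sum>a<d. r a a) = 1" and C: "finite C"
    and r: "\<And>a b. a < d \<Longrightarrow> b < d \<Longrightarrow> r a b = (\<Sum>c\<in>C. G a c * cnj (G b c))"
  defines "m \<equiv> n div k" and "T \<equiv> Re (\<Sum>a<d. kmul {..<d} (kmul {..<d} A A) r a a)"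
    and "\<mu>2 \<equiv> Re ((cyc_mean d A r k)\<^sup>2)"
  shows "Re (expct n d r (kmul (words n d) (estimator n d A k) (kadj (estimator n d A k))))
    \<le> (T + (real m - 1) * \<mu>2) / m"
proof -
  let ?S = "{s. s permutes {..<n}}"
  let ?c = "\<lambda>s b. cyc_op d A k (s \<circ> block_swap k b)"
  have gram: "expct n d r (kmul (words n d) K (kadj L)) = amp_inner n d C G K L" for K L
    using C r by (rule expct_gram)
  have m: "0 < m" using k by (simp add: m_def div_greater_zero_iff)
  have bk: "b * k + k \<le> n" if "b < m" for b
  proof -
    have "Suc b * k \<le> m * k" using that by (intro mult_le_mono1) simp
    also have "\<dots> \<le> n" by (simp add: m_def)
    finally show ?thesis by simp
  qed
  have S: "finite ?S" "?S \<noteq> {}" "card ?S = fact n"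
    using permutes_id[of "{..<n}"] card_permutations[of "{..<n}" n]
    by (auto simp: finite_permutations simp del: permutes_id)
  define B where "B s w x = (\<Sum>b<m. ?c s b w x) / of_real (real m)" for s w x
  have mean: "estimator n d A k = (\<lambda>w x. (\<Sum>s\<in>?S. B s w x) / of_nat (card ?S))"
  proof (intro ext)
    fix w x
    have "(\<Sum>s\<in>?S. B s w x) = (\<Sum>b<m. \<Sum>s\<in>?S. ?c s b w x) / of_real (real m)"
      unfolding B_def sum_divide_distrib[symmetric] by (subst sum.swap) simp
    \<comment> \<open>For fixed \<open>b\<close>, composition with \<open>block_swap k b\<close>
      only permutes the sum over all \<open>s\<close>, so each block alone reproduces the full
      average.\<close>
    also have "(\<Sum>b<m. \<Sum>s\<in>?S. ?c s b w x) = (\<Sum>b<m. \<Sum>s\<in>?S. cyc_op d A k s w x)"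
      using cyc_op_sum_shift[OF block_swap_permutes[OF bk]] by (rule sum.cong[OF refl]) simp
    also have "\<dots> / of_real (real m) = (\<Sum>s\<in>?S. cyc_op d A k s w x)" using m by simp
    finally show "estimator n d A k w x = (\<Sum>s\<in>?S. B s w x) / of_nat (card ?S)"
      by (simp add: estimator_def sym_op_def cyc_op_def S(3))
  qed
  have BB: "Re (amp_inner n d C G (B s) (B s)) = (T + (real m - 1) * \<mu>2) / m" if "s \<in> ?S" for s
  proof -
    have s: "s permutes {..<n}" using that by simp
    have perm: "s \<circ> block_swap k b permutes {..<n}" if "b < m" for b
      by (rule permutes_compose[OF block_swap_permutes[OF bk[OF that]] s])
    have same: "Re (amp_inner n d C G (?c s b) (?c s b)) = T" if "b < m" for b
      unfolding T_def gram[symmetric]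
      using expct_cyc_op_same[where r = r, OF perm[OF that] k herm tr] by simp
    have diff: "Re (amp_inner n d C G (?c s b) (?c s c)) = \<mu>2" if "b < m" "c < m" "b \<noteq> c" for b c
    proof -
      have "(s \<circ> block_swap k b) ` {..<k} \<inter> (s \<circ> block_swap k c) ` {..<k} = {}"
        using block_swap_image_disjoint[OF that(3), of k] permutes_inj[OF s]
        unfolding image_comp[symmetric] by (simp add: image_Int[symmetric])
      then show ?thesis unfolding \<mu>2_def gram[symmetric]
        using expct_cyc_op_disjoint[where r = r, OF perm[OF that(1)] perm[OF that(2)] k herm tr] by simp
    qed
    \<comment> \<open>A row of the Gram matrix of the \<open>m\<close> blocks has one diagonal entry
      \<open>T\<close> and \<open>m - 1\<close> entries \<open>\<mu>2\<close>.\<close>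
    have row: "(\<Sum>c<m. Re (amp_inner n d C G (?c s b) (?c s c))) = T + (real m - 1) * \<mu>2" if "b < m" for b
    proof -
      have "(\<Sum>c<m. Re (amp_inner n d C G (?c s b) (?c s c))) = T + (\<Sum>c\<in>{..<m}-{b}. \<mu>2)"
        using that same diff by (subst sum.remove[of _ b]) auto
      then show ?thesis using that m by (simp add: of_nat_diff)
    qed
    have "Re (amp_inner n d C G (B s) (B s)) =
        (\<Sum>b<m. \<Sum>c<m. Re (amp_inner n d C G (?c s b) (?c s c))) / (real m)\<^sup>2"
      unfolding B_def[abs_def] amp_inner_scaled_sums by (simp only: Re_divide_of_real Re_sum)
    also have "\<dots> = (\<Sum>b<m. T + (real m - 1) * \<mu>2) / (real m)\<^sup>2"
      using row by simp
    also have "\<dots> = (T + (real m - 1) * \<mu>2) / m" using m by (simp add: power2_eq_square)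
    finally show ?thesis .
  qed
  have "Re (expct n d r (kmul (words n d) (estimator n d A k) (kadj (estimator n d A k)))) =
      Re (amp_inner n d C G (estimator n d A k) (estimator n d A k))"
    by (simp add: gram)
  also have "\<dots> \<le> (\<Sum>s\<in>?S. Re (amp_inner n d C G (B s) (B s))) / card ?S"
    unfolding mean by (rule amp_inner_mean_le[OF S(1,2)])
  also have "\<dots> = (\<Sum>s\<in>?S. (T + (real m - 1) * \<mu>2) / m) / card ?S"
    using BB by simp
  also have "\<dots> = (T + (real m - 1) * \<mu>2) / m"
    using S by (simp add: card_gt_0_iff)
  finally show ?thesis .
qed

lemma expct_estimator:
  assumes k: "0 < k" "k \<le> n" and tr: "(\<Sum>a<d. r a a) = 1"
  shows "expct n d r (estimator n d A k) = cyc_mean d A r k"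
proof -
  let ?S = "{s. s permutes {..<n}}"
  have card: "card ?S = fact n" using card_permutations[of "{..<n}" n] by simp
  have "expct n d r (estimator n d A k) =
      (\<Sum>w\<in>words n d. \<Sum>v\<in>words n d. \<Sum>s\<in>?S. cyc_op d A k s w v * tensor_kernel n r v w) / of_nat (fact n)"
    unfolding expct_def estimator_def sym_op_def cyc_op_def
    by (simp add: sum_distrib_right sum_divide_distrib)
  also have "(\<Sum>w\<in>words n d. \<Sum>v\<in>words n d. \<Sum>s\<in>?S. cyc_op d A k s w v * tensor_kernel n r v w) =
      (\<Sum>w\<in>words n d. \<Sum>s\<in>?S. \<Sum>v\<in>words n d. cyc_op d A k s w v * tensor_kernel n r v w)"
    by (intro sum.cong refl sum.swap)
  also have "\<dots> = (\<Sum>s\<in>?S. expct n d r (cyc_op d A k s))"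
    unfolding expct_def by (rule sum.swap)
  also have "\<dots> = of_nat (fact n) * cyc_mean d A r k"
    using expct_cyc_op[where r = r, OF _ k tr] card by simp
  finally show ?thesis by simp
qed

lemma estimator_hermitian:
  assumes "w \<in> words n d" "x \<in> words n d" "0 < k" "k \<le> n" "kadj A = A"
  shows "cnj (estimator n d A k x w) = estimator n d A k w x"
  unfolding estimator_def using sym_op_hermitian[OF assms(1,2) _ cyc_permutes assms(5)] assms by simp

lemma estimator_commute:
  assumes "w \<in> words n d" "x \<in> words n d" "0 < k" "k \<le> n" "0 < l" "l \<le> n" "kadj A = A"
  shows "kmul (words n d) (estimator n d A k) (estimator n d A l) w x =
    kmul (words n d) (estimator n d A l) (estimator n d A k) w x"
proof -
  have "kmul (words n d) (estimator n d A i) (estimator n d A j) w x =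
    kmul (words n d) (sym_op n d A 0 (cyc i)) (sym_op n d A 0 (cyc j)) w x / (of_nat (fact n))\<^sup>2" for i j
    unfolding kmul_def estimator_def by (simp add: sum_divide_distrib power2_eq_square)
  then show ?thesis
    using sym_op_commute[OF assms(1,2) _ _ cyc_permutes cyc_permutes assms(7)] assms by simp
qed

section \<open>Positive matrices, operator norm and tensor powers\<close>

lemma index_mat_adjoint:
  fixes A :: "complex mat"
  assumes "A \<in> carrier_mat m n" "i < n" "j < m"
  shows "mat_adjoint A $$ (i, j) = cnj (A $$ (j, i))"
  using assms by (simp add: mat_adjoint_def mat_of_rows_def)

lemma hermitian_mat_iff:
  assumes A: "A \<in> carrier_mat D D"
  shows "hermitian_mat D A \<longleftrightarrow> (\<forall>i<D. \<forall>j<D. cnj (A $$ (j, i)) = A $$ (i, j))"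
proof
  assume "hermitian_mat D A"
  then have adj: "A $$ (i, j) = mat_adjoint A $$ (i, j)" for i j by (simp add: hermitian_mat_def)
  show "\<forall>i<D. \<forall>j<D. cnj (A $$ (j, i)) = A $$ (i, j)"
  proof (intro allI impI)
    fix i j assume "i < D" "j < D"
    then show "cnj (A $$ (j, i)) = A $$ (i, j)"
      unfolding adj[of i j] using index_mat_adjoint[OF A, of i j] by simp
  qed
next
  assume sym: "\<forall>i<D. \<forall>j<D. cnj (A $$ (j, i)) = A $$ (i, j)"
  have "dim_row (mat_adjoint A) = D" "dim_col (mat_adjoint A) = D"
    unfolding mat_adjoint_def using carrier_matD[OF A] by simp_all
  then have "mat_adjoint A \<in> carrier_mat D D" by (rule carrier_matI)
  then have "mat_adjoint A = A"
  proof (intro eq_matI)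
    fix i j assume "i < dim_row A" "j < dim_col A"
    then have "i < D" "j < D" using A by auto
    then show "mat_adjoint A $$ (i, j) = A $$ (i, j)"
      unfolding index_mat_adjoint[OF A \<open>i < D\<close> \<open>j < D\<close>] using sym by blast
  qed (use A in auto)
  then show "hermitian_mat D A" using A by (simp add: hermitian_mat_def)
qed

lemma kadj_kernel_of_mat: "hermitian_mat D A \<Longrightarrow> kadj (kernel_of_mat D A) = kernel_of_mat D A"
  using hermitian_mat_iff[of A D] by (auto simp: hermitian_mat_def kadj_def kernel_of_mat_def fun_eq_iff)

lemma cinner_mult_mat_vec:
  assumes "A \<in> carrier_mat D D" "dim_vec v = D"
  shows "cinner v (A *\<^sub>v v) = (\<Sum>i<D. cnj (v $ i) * (\<Sum>j<D. A $$ (i, j) * v $ j))"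
  using assms by (auto simp: cinner_def scalar_prod_def atLeast0LessThan intro!: sum.cong)

lemma kernel_quadratic_form:
  "(\<Sum>i\<in>W. cnj (v i) * (\<Sum>j\<in>W. kmul W (kadj K) K i j * v j)) =
    of_real (\<Sum>c\<in>W. (cmod (\<Sum>j\<in>W. K c j * v j))\<^sup>2)"
proof -
  have "(\<Sum>i\<in>W. cnj (v i) * (\<Sum>j\<in>W. kmul W (kadj K) K i j * v j)) =
    (\<Sum>i\<in>W. \<Sum>j\<in>W. \<Sum>c\<in>W. cnj (K c i * v i) * (K c j * v j))"
    by (simp add: kmul_def kadj_def sum_distrib_left sum_distrib_right mult_ac)
  also have "\<dots> = (\<Sum>i\<in>W. \<Sum>c\<in>W. \<Sum>j\<in>W. cnj (K c i * v i) * (K c j * v j))"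
    by (intro sum.cong refl sum.swap)
  also have "\<dots> = (\<Sum>c\<in>W. \<Sum>i\<in>W. \<Sum>j\<in>W. cnj (K c i * v i) * (K c j * v j))"
    by (rule sum.swap)
  also have "\<dots> = (\<Sum>c\<in>W. cnj (\<Sum>i\<in>W. K c i * v i) * (\<Sum>j\<in>W. K c j * v j))"
    by (simp add: sum_product)
  also have "\<dots> = of_real (\<Sum>c\<in>W. (cmod (\<Sum>j\<in>W. K c j * v j))\<^sup>2)"
    unfolding of_real_sum complex_norm_square by (simp add: mult.commute)
  finally show ?thesis .
qed

text \<open>A Hermitian projection is its adjoint times itself, so its quadratic form is a squared
  norm.\<close>

lemma psd_mat_projection:
  assumes E: "kernel_on {..<D} E" "kadj E = E" "kmul {..<D} E E = E"
  shows "psd_mat D (mat D D (\<lambda>(i, j). E i j))"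
proof -
  let ?A = "mat D D (\<lambda>(i, j). E i j)"
  have "cinner v (?A *\<^sub>v v) = of_real (\<Sum>c<D. (cmod (\<Sum>j<D. E c j * v $ j))\<^sup>2)" if "dim_vec v = D" for v
  proof -
    have "cinner v (?A *\<^sub>v v) = (\<Sum>i<D. cnj (v $ i) * (\<Sum>j<D. ?A $$ (i, j) * v $ j))"
      using that by (intro cinner_mult_mat_vec) simp_all
    also have "\<dots> = (\<Sum>i<D. cnj (v $ i) * (\<Sum>j<D. E i j * v $ j))" by simp
    finally show ?thesis
      using kernel_quadratic_form[where W = "{..<D}" and v = "\<lambda>i. v $ i" and K = E] by (simp only: E)
  qed
  moreover have "hermitian_mat D ?A"
    using fun_cong[OF fun_cong[OF E(2)]] by (subst hermitian_mat_iff) (auto simp: kadj_def)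
  ultimately show ?thesis unfolding psd_mat_def by (auto intro!: sum_nonneg)
qed

text \<open>The factor consists of the columns of the spectral projections, scaled by square roots
  of the eigenvalues; it has one column for each pair of an eigenvalue and a basis index.\<close>

lemma psd_mat_factor:
  assumes "psd_mat d R"
  obtains C :: "(real \<times> nat) set" and G where "finite C"
    "\<And>a b. a < d \<Longrightarrow> b < d \<Longrightarrow> R $$ (a, b) = (\<Sum>c\<in>C. G a c * cnj (G b c))"
proof -
  let ?W = "{..<d}"
  define K where "K = kernel_of_mat d R"
  have car: "R \<in> carrier_mat d d" and herm: "hermitian_mat d R"
    using assms by (auto simp: psd_mat_def hermitian_mat_def)
  have K: "kernel_on ?W K" "kadj K = K" using kadj_kernel_of_mat[OF herm] by (simp_all add: K_def)
  obtain S :: "real set" and E where S: "finite S"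
    and E: "\<And>s. s \<in> S \<Longrightarrow> kernel_on ?W (E s)" "\<And>s. s \<in> S \<Longrightarrow> kadj (E s) = E s"
      "\<And>s. s \<in> S \<Longrightarrow> kmul ?W (E s) (E s) = E s"
    and KE: "\<And>s. s \<in> S \<Longrightarrow> kmul ?W K (E s) = (\<lambda>a b. of_real s * E s a b)"
    and sum: "(\<lambda>a b. \<Sum>s\<in>S. E s a b) = kid ?W"
    by (rule hermitian_spectral_resolution[OF K], rule that, assumption+)
  \<comment> \<open>The columns of \<open>E s\<close> are eigenvectors for \<open>s\<close>, and
    positivity of \<open>R\<close> on such a column rules out \<open>s < 0\<close> unless the column
    is zero.\<close>
  have neg: "E s a b = 0" if s: "s \<in> S" "s < 0" for s a b
  proof -
    have "E s c b = 0" if "c < d" "b < d" for c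
    proof -
      define v where "v = vec d (\<lambda>i. E s i b)"
      have "cinner v (R *\<^sub>v v) = (\<Sum>i<d. cnj (E s i b) * kmul ?W K (E s) i b)"
      proof -
        have "cinner v (R *\<^sub>v v) = (\<Sum>i<d. cnj (v $ i) * (\<Sum>j<d. R $$ (i, j) * v $ j))"
          using car by (rule cinner_mult_mat_vec) (simp add: v_def)
        also have "\<dots> = (\<Sum>i<d. cnj (E s i b) * kmul ?W K (E s) i b)"
        proof (rule sum.cong[OF refl])
          fix i assume i: "i \<in> {..<d}"
          have "(\<Sum>j<d. R $$ (i, j) * v $ j) = kmul ?W K (E s) i b"
            unfolding kmul_def by (rule sum.cong[OF refl]) (use i in \<open>simp add: v_def K_def kernel_of_mat_def\<close>)
          then show "cnj (v $ i) * (\<Sum>j<d. R $$ (i, j) * v $ j) = cnj (E s i b) * kmul ?W K (E s) i b"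
            using i by (simp add: v_def)
        qed
        finally show ?thesis .
      qed
      also have "\<dots> = of_real s * (\<Sum>i<d. E s i b * cnj (E s i b))"
        by (simp add: KE[OF s(1)] sum_distrib_left mult_ac)
      also have "\<dots> = of_real (s * (\<Sum>i<d. (cmod (E s i b))\<^sup>2))"
        by (simp flip: complex_norm_square)
      finally have "0 \<le> s * (\<Sum>i<d. (cmod (E s i b))\<^sup>2)"
        using assms by (auto simp: psd_mat_def v_def dest!: spec[of _ v])
      then have "(\<Sum>i<d. (cmod (E s i b))\<^sup>2) \<le> 0" using s(2) by (simp add: zero_le_mult_iff)
      moreover have "(\<Sum>i<d. (cmod (E s i b))\<^sup>2) \<ge> 0" by (intro sum_nonneg) simp
      ultimately have "(\<Sum>i<d. (cmod (E s i b))\<^sup>2) = 0" by simp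
      then have "\<forall>i\<in>?W. (cmod (E s i b))\<^sup>2 = 0" by (subst (asm) sum_nonneg_eq_0_iff) auto
      then show "E s c b = 0" using that by simp
    qed
    then show ?thesis using E(1)[OF s(1)] by (cases "a < d \<and> b < d") (auto simp: kernel_on_def)
  qed
  \<comment> \<open>Clipping at 0 makes the square root square back to its argument; for negative
    \<open>s\<close> the projection \<open>E s\<close> is zero.\<close>
  define G where "G a = (\<lambda>(s, c). of_real (sqrt (max s 0)) * E s a c)" for a
  have "R $$ (a, b) = (\<Sum>c\<in>S \<times> ?W. G a c * cnj (G b c))" if "a < d" "b < d" for a b
  proof -
    have "(\<Sum>c\<in>S \<times> ?W. G a c * cnj (G b c)) = (\<Sum>s\<in>S. \<Sum>c<d. G a (s, c) * cnj (G b (s, c)))"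
      by (simp add: sum.cartesian_product case_prod_beta)
    also have "\<dots> = (\<Sum>s\<in>S. of_real (max s 0) * kmul ?W (E s) (kadj (E s)) a b)"
    proof (rule sum.cong[OF refl])
      fix s
      define q where "q = complex_of_real (sqrt (max s 0))"
      have q: "q * q = of_real (max s 0)" by (simp add: q_def flip: of_real_mult)
      have "G a (s, c) * cnj (G b (s, c)) = (q * q) * (E s a c * kadj (E s) c b)" for c
        by (simp add: G_def kadj_def q_def[symmetric]) (simp add: q_def)
      then show "(\<Sum>c<d. G a (s, c) * cnj (G b (s, c))) = of_real (max s 0) * kmul ?W (E s) (kadj (E s)) a b"
        unfolding kmul_def sum_distrib_left q by simp
    qed
    also have "\<dots> = (\<Sum>s\<in>S. of_real s * E s a b)"
    proof (rule sum.cong[OF refl])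
      fix s assume "s \<in> S"
      then show "of_real (max s 0) * kmul ?W (E s) (kadj (E s)) a b = of_real s * E s a b"
        using E neg by (cases "s < 0") (simp_all add: max_def)
    qed
    also have "\<dots> = kmul ?W K (kid ?W) a b"
      unfolding sum[symmetric] kmul_sum_right by (simp add: KE)
    also have "\<dots> = R $$ (a, b)" using K that by (simp add: kmul_kid_right) (simp add: K_def kernel_of_mat_def)
    finally show ?thesis by simp
  qed
  then show thesis using S by (intro that[of "S \<times> ?W" G]) auto
qed

lemma mult_mat_vec_index:
  assumes "A \<in> carrier_mat d d" "dim_vec v = d" "i < d"
  shows "(A *\<^sub>v v) $ i = (\<Sum>j<d. A $$ (i, j) * v $ j)"
  using assms by (simp add: scalar_prod_def atLeast0LessThan)

lemma vnorm_mult_le: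
  assumes A: "A \<in> carrier_mat d d" and v: "dim_vec v = d"
  shows "vnorm (A *\<^sub>v v) \<le> op_norm A * vnorm v"
proof (cases "vnorm v = 0")
  case True
  then have "\<forall>i<d. v $ i = 0"
    using v by (auto simp: vnorm_def sum_nonneg_eq_0_iff)
  then have "vnorm (A *\<^sub>v v) = 0"
    using A v by (simp add: vnorm_def mult_mat_vec_index[OF A v] del: index_mult_mat_vec)
  then show ?thesis using True by simp
next
  case False
  let ?N = "{vnorm (A *\<^sub>v u) | u. dim_vec u = dim_col A \<and> vnorm u = 1}"
  have pos: "vnorm v > 0" using False by (simp add: vnorm_def sum_nonneg less_le)
  \<comment> \<open>A supremum of reals is an upper bound only for a bounded set. A crude bound
    suffices: the entries of a unit vector have modulus at most 1, so absolute row sums control its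
    image.\<close>
  have bdd: "bdd_above ?N"
  proof (rule bdd_aboveI)
    fix x assume "x \<in> ?N"
    then obtain u where u: "dim_vec u = d" "vnorm u = 1" and x: "x = vnorm (A *\<^sub>v u)"
      using A by auto
    have u1: "cmod (u $ j) \<le> 1" if "j < d" for j
    proof -
      have "(cmod (u $ j))\<^sup>2 \<le> (\<Sum>i<d. (cmod (u $ i))\<^sup>2)"
        using that by (intro member_le_sum) auto
      also have "\<dots> = 1" using u by (simp add: vnorm_def)
      finally show ?thesis by (simp add: abs_square_le_1)
    qed
    have "cmod (\<Sum>j<d. A $$ (i, j) * u $ j) \<le> (\<Sum>j<d. cmod (A $$ (i, j)))" for i
      using u1 by (intro sum_norm_le) (auto simp: norm_mult mult_left_le)
    then have "(\<Sum>i<d. (cmod (\<Sum>j<d. A $$ (i, j) * u $ j))\<^sup>2) \<le> (\<Sum>i<d. (\<Sum>j<d. cmod (A $$ (i, j)))\<^sup>2)"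
      by (intro sum_mono power_mono) auto
    then show "x \<le> sqrt (\<Sum>i<d. (\<Sum>j<d. cmod (A $$ (i, j)))\<^sup>2)"
      unfolding x vnorm_def using A u by (simp add: mult_mat_vec_index[OF A u(1)] del: index_mult_mat_vec)
  qed
  define u where "u = vec d (\<lambda>i. v $ i / of_real (vnorm v))"
  have u: "dim_vec u = d" by (simp add: u_def)
  have scale: "sqrt (\<Sum>i<d. (cmod (f i / of_real (vnorm v)))\<^sup>2) = sqrt (\<Sum>i<d. (cmod (f i))\<^sup>2) / vnorm v" for f
    using pos by (simp add: norm_divide power_divide real_sqrt_divide flip: sum_divide_distrib)
  have "vnorm u = 1"
    using scale[of "\<lambda>i. v $ i"] pos v by (simp add: vnorm_def u_def)
  moreover have "vnorm (A *\<^sub>v u) = vnorm (A *\<^sub>v v) / vnorm v"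
  proof -
    have "(\<Sum>j<d. A $$ (i, j) * u $ j) = (\<Sum>j<d. A $$ (i, j) * v $ j) / of_real (vnorm v)" for i
      by (simp add: u_def sum_divide_distrib)
    then show ?thesis
      using A scale[of "\<lambda>i. \<Sum>j<d. A $$ (i, j) * v $ j"]
      by (simp add: vnorm_def[of "A *\<^sub>v _"] mult_mat_vec_index[OF A u] mult_mat_vec_index[OF A v] del: index_mult_mat_vec)
  qed
  ultimately have "vnorm (A *\<^sub>v v) / vnorm v \<in> ?N"
    using u A by (intro CollectI exI[of _ u]) simp
  then have "vnorm (A *\<^sub>v v) / vnorm v \<le> op_norm A"
    unfolding op_norm_def by (rule cSup_upper[OF _ bdd])
  then show ?thesis using pos by (simp add: field_simps)
qed

text \<open>With \<open>g c\<close> the columns of the factor of the state, the trace is the sum of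
  the squared norms of \<open>A\<close> applied to \<open>g c\<close>, while the squared norms of
  the \<open>g c\<close> add up to the trace of \<open>r\<close>, which is 1.\<close>

lemma trace_square_le_op_norm:
  assumes A: "hermitian_mat d A" and C: "finite C" and tr: "(\<Sum>a<d. r a a) = 1"
    and r: "\<And>a b. a < d \<Longrightarrow> b < d \<Longrightarrow> r a b = (\<Sum>c\<in>C. G a c * cnj (G b c))"
  shows "Re (\<Sum>a<d. kmul {..<d} (kmul {..<d} (kernel_of_mat d A) (kernel_of_mat d A)) r a a) \<le> (op_norm A)\<^sup>2"
proof -
  let ?W = "{..<d}" and ?K = "kernel_of_mat d A"
  have car: "A \<in> carrier_mat d d" using A by (simp add: hermitian_mat_def)
  define g where "g c = vec d (\<lambda>b. G b c)" for c
  have n2: "(vnorm v)\<^sup>2 = (\<Sum>i<dim_vec v. (cmod (v $ i))\<^sup>2)" for v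
    by (simp add: vnorm_def sum_nonneg)
  have Ag: "(vnorm (A *\<^sub>v g c))\<^sup>2 = (\<Sum>e<d. (cmod (\<Sum>j<d. ?K e j * G j c))\<^sup>2)" for c
    unfolding n2 using car by (auto simp: scalar_prod_def atLeast0LessThan g_def kernel_of_mat_def intro!: sum.cong arg_cong[where f = "\<lambda>z. (cmod z)\<^sup>2"])
  have "(\<Sum>a<d. kmul ?W (kmul ?W ?K ?K) r a a) =
      (\<Sum>a<d. \<Sum>b<d. \<Sum>c\<in>C. kmul ?W ?K ?K a b * (G b c * cnj (G a c)))"
    unfolding kmul_def[of _ _ r] by (intro sum.cong refl) (simp add: r sum_distrib_left)
  also have "\<dots> = (\<Sum>a<d. \<Sum>c\<in>C. \<Sum>b<d. kmul ?W ?K ?K a b * (G b c * cnj (G a c)))"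
    by (intro sum.cong refl sum.swap)
  also have "\<dots> = (\<Sum>c\<in>C. \<Sum>a<d. \<Sum>b<d. kmul ?W ?K ?K a b * (G b c * cnj (G a c)))"
    by (rule sum.swap)
  also have "\<dots> = (\<Sum>c\<in>C. of_real ((vnorm (A *\<^sub>v g c))\<^sup>2))"
    unfolding Ag kernel_quadratic_form[symmetric] kadj_kernel_of_mat[OF A]
    by (simp add: sum_distrib_left mult_ac)
  finally have "Re (\<Sum>a<d. kmul ?W (kmul ?W ?K ?K) r a a) = (\<Sum>c\<in>C. (vnorm (A *\<^sub>v g c))\<^sup>2)"
    by (simp add: Re_sum)
  also have "\<dots> \<le> (\<Sum>c\<in>C. (op_norm A * vnorm (g c))\<^sup>2)"
    by (intro sum_mono power_mono vnorm_mult_le[OF car]) (simp_all add: g_def vnorm_def sum_nonneg)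
  also have "\<dots> = (op_norm A)\<^sup>2 * (\<Sum>c\<in>C. (vnorm (g c))\<^sup>2)"
    by (simp add: power_mult_distrib sum_distrib_left)
  also have "(\<Sum>c\<in>C. (vnorm (g c))\<^sup>2) = 1"
  proof -
    have "complex_of_real (\<Sum>c\<in>C. (vnorm (g c))\<^sup>2) = (\<Sum>c\<in>C. \<Sum>a<d. G a c * cnj (G a c))"
      unfolding n2 of_real_sum complex_norm_square by (simp add: g_def)
    also have "\<dots> = (\<Sum>a<d. r a a)" by (subst sum.swap) (simp add: r)
    finally show ?thesis using tr by (metis of_real_1 of_real_eq_iff)
  qed
  finally show ?thesis by simp
qed

section \<open>Matrix indices of tensor powers as words\<close>

definition digits :: "nat \<Rightarrow> nat \<Rightarrow> nat \<Rightarrow> nat \<Rightarrow> nat" where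
  "digits n d i = restrict (\<lambda>t. i div d ^ t mod d) {..<n}"

lemma digits_eqD:
  "i < d ^ n \<Longrightarrow> j < d ^ n \<Longrightarrow> (\<And>t. t < n \<Longrightarrow> i div d ^ t mod d = j div d ^ t mod d) \<Longrightarrow> i = (j :: nat)"
proof (induction n arbitrary: i j)
  case (Suc n)
  have "i div d = j div d"
  proof (rule Suc.IH)
    show "i div d < d ^ n" "j div d < d ^ n"
      using Suc.prems by (simp_all add: less_mult_imp_div_less mult.commute)
    show "i div d div d ^ t mod d = j div d div d ^ t mod d" if "t < n" for t
      using Suc.prems(3)[of "Suc t"] that by (simp add: div_mult2_eq)
  qed
  moreover have "i mod d = j mod d" using Suc.prems(3)[of 0] by simp
  ultimately show ?case by (metis mult_div_mod_eq)
qed simp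

lemma bij_betw_digits:
  assumes "d \<ge> 1"
  shows "bij_betw (digits n d) {..<d ^ n} (words n d)"
proof -
  have inj: "inj_on (digits n d) {..<d ^ n}"
    by (rule inj_onI, rule digits_eqD[of _ d n])
      (auto simp: digits_def restrict_def fun_eq_iff, metis)
  have sub: "digits n d ` {..<d ^ n} \<subseteq> words n d"
    using assms by (auto simp: digits_def words_def split: if_splits)
  have "card (digits n d ` {..<d ^ n}) = card (words n d)"
    by (simp add: card_image[OF inj] words_def card_PiE)
  then show ?thesis using inj sub by (simp add: bij_betw_def card_subset_eq)
qed

text \<open>\<open>kron\<close> puts the new factor at the least significant digit, so digit
  \<open>0\<close> belongs to the factor added last. All factors are equal, hence this reversal does
  not affect the product.\<close>

lemma tensor_pow_index:
  assumes R: "R \<in> carrier_mat d d"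
  shows "tensor_pow R n \<in> carrier_mat (d ^ n) (d ^ n)"
    "i < d ^ n \<Longrightarrow> j < d ^ n \<Longrightarrow> tensor_pow R n $$ (i, j) = (\<Prod>t<n. R $$ (i div d ^ t mod d, j div d ^ t mod d))"
proof (induction n arbitrary: i j)
  case (Suc n)
  { case 1
    then show ?case using R Suc.IH(1) by (simp add: kron_def mult.commute) }
  { case 2
    have "i div d < d ^ n" "j div d < d ^ n"
      using 2 by (simp_all add: less_mult_imp_div_less mult.commute)
    then show ?case using R Suc.IH(1) 2 Suc.IH(2)[of "i div d" "j div d"]
      by (simp add: kron_def prod.lessThan_Suc_shift div_mult2_eq mult.commute del: prod.lessThan_Suc) }
qed simp_all

lemma kpow_Suc_left: "kpow d r (Suc m) a b = (\<Sum>c<d. r a c * kpow d r m c b)" if "a < d" "b < d"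
  using that
proof (induction m arbitrary: b)
  case 0
  have "(\<Sum>c<d. of_bool (a = c) * r c b) = (\<Sum>c<d. if a = c then r c b else 0)"
    "(\<Sum>c<d. r a c * of_bool (c = b)) = (\<Sum>c<d. if c = b then r a c else 0)"
    by (auto intro!: sum.cong)
  then show ?case using 0 by simp
next
  case (Suc m)
  have "kpow d r (Suc (Suc m)) a b = (\<Sum>e<d. (\<Sum>c<d. r a c * kpow d r m c e) * r e b)"
    unfolding kpow.simps(2)[of d r "Suc m"]
  proof (rule sum.cong[OF refl])
    fix e assume "e \<in> {..<d}"
    then show "kpow d r (Suc m) a e * r e b = (\<Sum>c<d. r a c * kpow d r m c e) * r e b"
      using Suc.IH[of e] Suc.prems by (simp only: lessThan_iff)
  qed
  also have "\<dots> = (\<Sum>c<d. r a c * kpow d r (Suc m) c b)"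
    by (simp add: sum_distrib_left sum_distrib_right mult.assoc) (rule sum.swap)
  finally show ?case .
qed

lemma kpow_pow_mat:
  assumes R: "R \<in> carrier_mat d d" and "a < d" "b < d"
  shows "(R ^\<^sub>m m) $$ (a, b) = kpow d (kernel_of_mat d R) m a b"
  using assms(2,3)
proof (induction m arbitrary: b)
  case (Suc m)
  have "R ^\<^sub>m m \<in> carrier_mat d d" using R by (rule pow_carrier_mat)
  then show ?case using Suc R
    by (auto simp: scalar_prod_def atLeast0LessThan kernel_of_mat_def intro!: sum.cong)
qed (use R in simp)

lemma mtrace_mult:
  assumes "A \<in> carrier_mat d d" "B \<in> carrier_mat d d"
  shows "mtrace (A * B) = (\<Sum>i<d. \<Sum>j<d. A $$ (i, j) * B $$ (j, i))"
  using assms by (simp add: mtrace_def scalar_prod_def atLeast0LessThan)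

text \<open>Cyclicity of the trace carries the power of \<open>?r\<close> around to the right of the
  remaining factors, where it combines with the single \<open>?r\<close> there.\<close>

lemma cyc_mean_mtrace:
  assumes R: "R \<in> carrier_mat d d" and A: "A \<in> carrier_mat d d" and k: "0 < k"
  shows "cyc_mean d (kernel_of_mat d A) (kernel_of_mat d R) k = mtrace (A * (R ^\<^sub>m k))"
proof -
  let ?r = "kernel_of_mat d R" and ?A = "kernel_of_mat d A"
  obtain m where m: "k = Suc m" using k by (cases k) auto
  have "cyc_mean d ?A ?r k = (\<Sum>a<d. \<Sum>b<d. \<Sum>c<d. ?A b c * (?r c a * kpow d ?r m a b))"
    by (simp add: cyc_mean_def m kmul_def sum_distrib_left mult_ac)
  also have "\<dots> = (\<Sum>b<d. \<Sum>a<d. \<Sum>c<d. ?A b c * (?r c a * kpow d ?r m a b))"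
    by (rule sum.swap)
  also have "\<dots> = (\<Sum>b<d. \<Sum>c<d. \<Sum>a<d. ?A b c * (?r c a * kpow d ?r m a b))"
    by (intro sum.cong refl sum.swap)
  also have "\<dots> = (\<Sum>b<d. \<Sum>c<d. ?A b c * kpow d ?r k c b)"
    unfolding m by (intro sum.cong refl) (simp only: kpow_Suc_left lessThan_iff sum_distrib_left)
  also have "\<dots> = mtrace (A * (R ^\<^sub>m k))"
    unfolding mtrace_mult[OF A pow_carrier_mat[OF R]]
    by (intro sum.cong refl) (simp add: kpow_pow_mat[OF R], simp add: kernel_of_mat_def)
  finally show ?thesis .
qed

section \<open>The measurement\<close>

definition word_pullback :: "nat \<Rightarrow> nat \<Rightarrow> ((nat \<Rightarrow> nat) \<Rightarrow> (nat \<Rightarrow> nat) \<Rightarrow> complex) \<Rightarrow> nat \<Rightarrow> nat \<Rightarrow> complex" where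
  "word_pullback n d K a b = (if a < d ^ n \<and> b < d ^ n then K (digits n d a) (digits n d b) else 0)"

lemma kernel_on_word_pullback [simp]: "kernel_on {..<d ^ n} (word_pullback n d K)"
  by (auto simp: kernel_on_def word_pullback_def)

lemma digits_in_words: "d \<ge> 1 \<Longrightarrow> a < d ^ n \<Longrightarrow> digits n d a \<in> words n d"
  using bij_betw_apply[OF bij_betw_digits] by blast

lemma kmul_word_pullback:
  assumes "d \<ge> 1"
  shows "kmul {..<d ^ n} (word_pullback n d K) (word_pullback n d L) = word_pullback n d (kmul (words n d) K L)"
proof (intro ext)
  fix a b
  have "(\<Sum>c<d ^ n. K (digits n d a) (digits n d c) * L (digits n d c) (digits n d b)) =
      kmul (words n d) K L (digits n d a) (digits n d b)"
    unfolding kmul_def by (rule sum.reindex_bij_betw[OF bij_betw_digits[OF assms]])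
  then show "kmul {..<d ^ n} (word_pullback n d K) (word_pullback n d L) a b =
      word_pullback n d (kmul (words n d) K L) a b"
    by (simp add: kmul_def word_pullback_def)
qed

lemma word_pullback_trace:
  assumes d: "d \<ge> 1" and R: "R \<in> carrier_mat d d"
  shows "(\<Sum>i<d ^ n. \<Sum>j<d ^ n. word_pullback n d K i j * tensor_pow R n $$ (j, i)) =
    expct n d (kernel_of_mat d R) K"
proof -
  let ?g = "digits n d" and ?T = "tensor_kernel n (kernel_of_mat d R)"
  have "tensor_pow R n $$ (j, i) = ?T (?g j) (?g i)" if "i < d ^ n" "j < d ^ n" for i j
    using tensor_pow_index(2)[OF R that(2,1)] d
    by (simp add: tensor_kernel_def digits_def kernel_of_mat_def)
  then have "(\<Sum>i<d ^ n. \<Sum>j<d ^ n. word_pullback n d K i j * tensor_pow R n $$ (j, i)) =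
      (\<Sum>i<d ^ n. \<Sum>j<d ^ n. K (?g i) (?g j) * ?T (?g j) (?g i))"
    by (simp add: word_pullback_def)
  also have "\<dots> = (\<Sum>i<d ^ n. \<Sum>v\<in>words n d. K (?g i) v * ?T v (?g i))"
    by (intro sum.cong refl sum.reindex_bij_betw[OF bij_betw_digits[OF d]])
  also have "\<dots> = (\<Sum>w\<in>words n d. \<Sum>v\<in>words n d. K w v * ?T v w)"
    by (rule sum.reindex_bij_betw[OF bij_betw_digits[OF d]])
  finally show ?thesis by (simp add: expct_def)
qed

text \<open>By linearity of the trace, the average of \<open>f\<close> over the outcomes sees the
  measurement only through the operator \<open>L\<close>. This serves for the total probability, the
  mean and the second moment.\<close>

lemma outcome_prob_sum:
  assumes s: "\<sigma> \<in> carrier_mat D D"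
    and L: "\<And>i j. i < D \<Longrightarrow> j < D \<Longrightarrow> (\<Sum>x\<in>X. of_real (f x) * M x i j) = L i j"
  shows "(\<Sum>x\<in>X. outcome_prob (\<lambda>x. mat D D (\<lambda>(i, j). M x i j)) \<sigma> x * f x) =
    Re (\<Sum>i<D. \<Sum>j<D. L i j * \<sigma> $$ (j, i))"
proof -
  have "outcome_prob (\<lambda>x. mat D D (\<lambda>(i, j). M x i j)) \<sigma> x * f x =
      Re (\<Sum>i<D. \<Sum>j<D. of_real (f x) * M x i j * \<sigma> $$ (j, i))" for x
  proof -
    have "mtrace (mat D D (\<lambda>(i, j). M x i j) * \<sigma>) = (\<Sum>i<D. \<Sum>j<D. M x i j * \<sigma> $$ (j, i))"
      by (subst mtrace_mult[OF _ s]) simp_all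
    then have "outcome_prob (\<lambda>x. mat D D (\<lambda>(i, j). M x i j)) \<sigma> x * f x =
        Re (of_real (f x) * (\<Sum>i<D. \<Sum>j<D. M x i j * \<sigma> $$ (j, i)))"
      by (simp add: outcome_prob_def)
    then show ?thesis by (simp only: sum_distrib_left mult.assoc)
  qed
  then have "(\<Sum>x\<in>X. outcome_prob (\<lambda>x. mat D D (\<lambda>(i, j). M x i j)) \<sigma> x * f x) =
      Re (\<Sum>x\<in>X. \<Sum>i<D. \<Sum>j<D. of_real (f x) * M x i j * \<sigma> $$ (j, i))"
    by simp
  also have "(\<Sum>x\<in>X. \<Sum>i<D. \<Sum>j<D. of_real (f x) * M x i j * \<sigma> $$ (j, i)) =
      (\<Sum>i<D. \<Sum>x\<in>X. \<Sum>j<D. of_real (f x) * M x i j * \<sigma> $$ (j, i))" by (rule sum.swap)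
  also have "\<dots> = (\<Sum>i<D. \<Sum>j<D. \<Sum>x\<in>X. of_real (f x) * M x i j * \<sigma> $$ (j, i))"
    by (intro sum.cong refl sum.swap)
  also have "\<dots> = (\<Sum>i<D. \<Sum>j<D. L i j * \<sigma> $$ (j, i))"
    by (intro sum.cong refl) (simp add: L[symmetric] sum_distrib_right)
  finally show ?thesis .
qed

text \<open>Each \<open>M x\<close> maps into an eigenspace of \<open>P k\<close>, so inserting the
  resolution of the identity recovers \<open>P k\<close>, and applying \<open>P k\<close> once more
  squares the eigenvalue. For a general POVM the second moment operator can exceed the square of the
  first.\<close>

lemma joint_resolution_moments:
  assumes J: "joint_resolution D n P X M" and P: "kernel_on {..<D} (P k)" and k: "k < n"
  shows "(\<Sum>x\<in>X. of_real (x ! k) * M x a b) = P k a b"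
    "(\<Sum>x\<in>X. of_real ((x ! k)\<^sup>2) * M x a b) = kmul {..<D} (P k) (P k) a b"
proof -
  have 1: "(\<lambda>a b. \<Sum>x\<in>X. of_real (x ! k) * M x a b) = P k"
  proof -
    have "P k = kmul {..<D} (P k) (\<lambda>a b. \<Sum>x\<in>X. M x a b)"
      unfolding joint_resolutionD(6)[OF J] using P by (simp add: kmul_kid_right)
    also have "\<dots> = (\<lambda>a b. \<Sum>x\<in>X. of_real (x ! k) * M x a b)"
      unfolding kmul_sum_right using joint_resolutionD(7)[OF J _ k] by simp
    finally show ?thesis by simp
  qed
  then show "(\<Sum>x\<in>X. of_real (x ! k) * M x a b) = P k a b" by (simp add: fun_eq_iff)
  have "kmul {..<D} (P k) (P k) = (\<lambda>a b. \<Sum>x\<in>X. of_real (x ! k) * kmul {..<D} (P k) (M x) a b)"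
    by (subst (2) 1[symmetric]) (simp only: kmul_sum_right kmul_scale_right)
  then show "(\<Sum>x\<in>X. of_real ((x ! k)\<^sup>2) * M x a b) = kmul {..<D} (P k) (P k) a b"
    using joint_resolutionD(7)[OF J _ k] by (simp add: power2_eq_square mult.assoc)
qed

lemma expct_kid: "(\<Sum>a<d. r a a) = 1 \<Longrightarrow> expct n d r (kid (words n d)) = 1"
proof -
  assume tr: "(\<Sum>a<d. r a a) = 1"
  have "(\<Sum>v\<in>words n d. kid (words n d) w v * tensor_kernel n r v w) = tensor_kernel n r w w"
    if "w \<in> words n d" for w
  proof -
    have "(\<Sum>v\<in>words n d. kid (words n d) w v * tensor_kernel n r v w) =
        (\<Sum>v\<in>words n d. if w = v then tensor_kernel n r v w else 0)"
      using that by (intro sum.cong) (auto simp: kid_def)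
    then show ?thesis using that by simp
  qed
  then have "expct n d r (kid (words n d)) = (\<Sum>w\<in>words n d. \<Prod>t<n. r (w t) (w t))"
    by (simp add: expct_def tensor_kernel_def)
  also have "\<dots> = (\<Prod>t<n. \<Sum>a<d. r a a)"
    unfolding words_def by (subst prod_sum_PiE) auto
  finally show ?thesis by (simp add: tr)
qed

lemma kid_word_pullback:
  assumes "d \<ge> 1"
  shows "kid {..<d ^ n} = word_pullback n d (kid (words n d))"
  using bij_betw_digits[OF assms, of n] digits_in_words[OF assms]
  by (auto simp: kid_def word_pullback_def fun_eq_iff bij_betw_def inj_on_def)

text \<open>Outcome probabilities are defined by real parts; this lets the real mean be identified
  with the complex trace.\<close>

lemma expct_hermitian_real:
  assumes K: "\<And>w x. w \<in> words n d \<Longrightarrow> x \<in> words n d \<Longrightarrow> cnj (K x w) = K w x" and r: "kadj r = r"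
  shows "cnj (expct n d r K) = expct n d r K"
proof -
  have T: "cnj (tensor_kernel n r v w) = tensor_kernel n r w v" for v w
    using fun_cong[OF fun_cong[OF r]] by (simp add: tensor_kernel_def kadj_def)
  have "cnj (expct n d r K) = (\<Sum>w\<in>words n d. \<Sum>v\<in>words n d. K v w * tensor_kernel n r w v)"
    unfolding expct_def cnj_sum complex_cnj_mult T using K by simp
  also have "\<dots> = expct n d r K" unfolding expct_def by (rule sum.swap)
  finally show ?thesis .
qed

theorem theorem2p1:
  fixes d n :: nat and Obs :: "complex mat"
  assumes "d \<ge> 1" and "hermitian_mat d Obs" and "n \<ge> 1"
  shows "\<exists>(X :: real list set) (M :: real list \<Rightarrow> complex mat).
           povm (d ^ n) X M \<and> (\<forall>x\<in>X. length x = n) \<and>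
           (\<forall>\<rho>. density_mat d \<rho> \<longrightarrow>
              (\<forall>k\<in>{1..n}.
                 complex_of_real (meas_expect X M (tensor_pow \<rho> n) (\<lambda>p. p ! (k - 1)))
                   = mtrace (Obs * (\<rho> ^\<^sub>m k)) \<and>
                 meas_var X M (tensor_pow \<rho> n) (\<lambda>p. p ! (k - 1))
                   \<le> 2 * real k * (op_norm Obs)^2 / real n))"
proof -
  let ?D = "d ^ n"
  define A where "A = kernel_of_mat d Obs"
  have Obs: "Obs \<in> carrier_mat d d" using assms(2) by (simp add: hermitian_mat_def)
  have A: "kadj A = A" unfolding A_def by (rule kadj_kernel_of_mat[OF assms(2)])
  \<comment> \<open>List positions start at 0, so position \<open>k\<close> holds the estimate of
    order \<open>Suc k\<close>.\<close>
  define P where "P k = word_pullback n d (estimator n d A (Suc k))" for k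
  have P: "kernel_on {..<?D} (P k)" for k by (simp add: P_def)
  have "\<exists>X M. joint_resolution ?D n P X M"
  proof (rule commuting_hermitian_joint_resolution)
    fix k assume k: "k < n"
    show "kernel_on {..<?D} (P k)" by (rule P)
    show "kadj (P k) = P k"
      using estimator_hermitian[OF digits_in_words digits_in_words _ _ A] assms(1) k
      by (auto simp: P_def kadj_def word_pullback_def fun_eq_iff)
    fix l assume l: "l < n"
    have "word_pullback n d (kmul (words n d) (estimator n d A (Suc k)) (estimator n d A (Suc l))) a b =
      word_pullback n d (kmul (words n d) (estimator n d A (Suc l)) (estimator n d A (Suc k))) a b" for a b
      using estimator_commute[OF digits_in_words digits_in_words, of d a n b "Suc k" "Suc l" A] assms(1) k l A
      by (simp add: word_pullback_def)
    then show "kmul {..<?D} (P k) (P l) = kmul {..<?D} (P l) (P k)"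
      unfolding P_def kmul_word_pullback[OF assms(1)] by (simp add: fun_eq_iff)
  qed
  then obtain X M where J: "joint_resolution ?D n P X M" by blast
  define N where "N = (\<lambda>x. mat ?D ?D (\<lambda>(i, j). M x i j))"
  have "povm ?D X N"
    unfolding povm_def
  proof (intro conjI ballI allI impI)
    show "finite X" by (rule joint_resolutionD(1)[OF J])
    show "psd_mat ?D (N x)" if "x \<in> X" for x
      unfolding N_def using joint_resolutionD(3-5)[OF J that] by (rule psd_mat_projection)
    show "(\<Sum>x\<in>X. N x $$ (i, j)) = 1\<^sub>m ?D $$ (i, j)" if "i < ?D" "j < ?D" for i j
      using fun_cong[OF fun_cong[OF joint_resolutionD(6)[OF J]], of i j] that
      by (simp add: N_def kid_def)
  qed
  moreover have "complex_of_real (meas_expect X N (tensor_pow \<rho> n) (\<lambda>p. p ! (k - 1)))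
        = mtrace (Obs * (\<rho> ^\<^sub>m k)) \<and>
      meas_var X N (tensor_pow \<rho> n) (\<lambda>p. p ! (k - 1)) \<le> 2 * real k * (op_norm Obs)^2 / real n"
    if rho: "density_mat d \<rho>" and k: "k \<in> {1..n}" for \<rho> k
  proof -
    define r where "r = kernel_of_mat d \<rho>"
    have psd: "psd_mat d \<rho>" and R: "\<rho> \<in> carrier_mat d d" and hermR: "hermitian_mat d \<rho>"
      using rho by (auto simp: density_mat_def psd_mat_def hermitian_mat_def)
    have tr: "(\<Sum>a<d. r a a) = 1"
      using rho R by (simp add: density_mat_def mtrace_def r_def kernel_of_mat_def)
    have r: "kadj r = r" unfolding r_def by (rule kadj_kernel_of_mat[OF hermR])
    \<comment> \<open>The measurement is already fixed; this factorisation depends on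
      \<open>\<rho>\<close> and enters the analysis only.\<close>
    obtain C :: "(real \<times> nat) set" and G where C: "finite C"
      and G: "\<And>a b. a < d \<Longrightarrow> b < d \<Longrightarrow> \<rho> $$ (a, b) = (\<Sum>c\<in>C. G a c * cnj (G b c))"
      using psd_mat_factor[OF psd] by blast
    have rG: "r a b = (\<Sum>c\<in>C. G a c * cnj (G b c))" if "a < d" "b < d" for a b
      using G that by (simp add: r_def kernel_of_mat_def)
    have k': "0 < k" "k \<le> n" "k - 1 < n" "Suc (k - 1) = k" using k by auto
    let ?\<sigma> = "tensor_pow \<rho> n" and ?E = "estimator n d A k" and ?f = "\<lambda>p :: real list. p ! (k - 1)"
    have sigma: "?\<sigma> \<in> carrier_mat ?D ?D" by (rule tensor_pow_index(1)[OF R])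
    define \<mu> where "\<mu> = cyc_mean d A r k"
    have mu: "expct n d r ?E = \<mu>" unfolding \<mu>_def by (rule expct_estimator[where r = r, OF k'(1,2) tr])
    have hermE: "cnj (?E x w) = ?E w x" if "w \<in> words n d" "x \<in> words n d" for w x
      by (rule estimator_hermitian[OF that k'(1,2) A])
    have real: "complex_of_real (Re \<mu>) = \<mu>"
    proof -
      have "cnj \<mu> = \<mu>" unfolding mu[symmetric] using hermE r by (rule expct_hermitian_real)
      then show ?thesis by (simp add: complex_eq_iff)
    qed
    have P_eq: "P (k - 1) = word_pullback n d ?E" using k' by (simp add: P_def)
    note trace = word_pullback_trace[OF assms(1) R, folded r_def]
    have m0: "(\<Sum>x\<in>X. outcome_prob N ?\<sigma> x) = 1"
    proof -
      have "(\<Sum>x\<in>X. outcome_prob N ?\<sigma> x * 1) = Re (\<Sum>i<?D. \<Sum>j<?D. kid {..<?D} i j * ?\<sigma> $$ (j, i))"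
        unfolding N_def using fun_cong[OF fun_cong[OF joint_resolutionD(6)[OF J]]]
        by (intro outcome_prob_sum[OF sigma]) simp
      then show ?thesis unfolding kid_word_pullback[OF assms(1)] trace expct_kid[where r = r, OF tr] by simp
    qed
    have m1: "(\<Sum>x\<in>X. outcome_prob N ?\<sigma> x * ?f x) = Re \<mu>"
    proof -
      have "(\<Sum>x\<in>X. outcome_prob N ?\<sigma> x * ?f x) = Re (\<Sum>i<?D. \<Sum>j<?D. P (k - 1) i j * ?\<sigma> $$ (j, i))"
        unfolding N_def by (intro outcome_prob_sum[OF sigma] joint_resolution_moments(1)[OF J P k'(3)])
      then show ?thesis unfolding P_eq trace mu .
    qed
    have m2: "(\<Sum>x\<in>X. outcome_prob N ?\<sigma> x * (?f x)\<^sup>2) = Re (expct n d r (kmul (words n d) ?E ?E))"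
    proof -
      have "(\<Sum>x\<in>X. outcome_prob N ?\<sigma> x * (?f x)\<^sup>2) =
          Re (\<Sum>i<?D. \<Sum>j<?D. kmul {..<?D} (P (k - 1)) (P (k - 1)) i j * ?\<sigma> $$ (j, i))"
        unfolding N_def by (intro outcome_prob_sum[OF sigma] joint_resolution_moments(2)[OF J P k'(3)])
      then show ?thesis unfolding P_eq kmul_word_pullback[OF assms(1)] trace .
    qed
    have mean: "meas_expect X N ?\<sigma> ?f = Re \<mu>" using m1 by (simp add: meas_expect_def)
    have "meas_var X N ?\<sigma> ?f = (\<Sum>x\<in>X. outcome_prob N ?\<sigma> x * (?f x)\<^sup>2)
        - 2 * Re \<mu> * (\<Sum>x\<in>X. outcome_prob N ?\<sigma> x * ?f x) + (Re \<mu>)\<^sup>2 * (\<Sum>x\<in>X. outcome_prob N ?\<sigma> x)"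
      unfolding meas_var_def mean
      by (simp add: power2_diff algebra_simps sum.distrib sum_subtractf sum_distrib_left)
    then have var: "meas_var X N ?\<sigma> ?f = Re (expct n d r (kmul (words n d) ?E ?E)) - (Re \<mu>)\<^sup>2"
      unfolding m0 m1 m2 by (simp add: power2_eq_square)
    define m where "m = n div k"
    define T where "T = Re (\<Sum>a<d. kmul {..<d} (kmul {..<d} A A) r a a)"
    have m: "0 < m" using k' by (simp add: m_def div_greater_zero_iff)
    \<comment> \<open>The second moment bound contains the real part of a square; it matches the
      squared mean because \<open>\<mu>\<close> is real.\<close>
    have "Re (\<mu>\<^sup>2) = (Re \<mu>)\<^sup>2" by (subst real[symmetric]) (simp flip: of_real_power)
    moreover have "expct n d r (kmul (words n d) ?E ?E) = expct n d r (kmul (words n d) ?E (kadj ?E))"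
      using hermE by (intro expct_cong) (simp add: kmul_def kadj_def)
    ultimately have "Re (expct n d r (kmul (words n d) ?E ?E)) \<le> (T + (real m - 1) * (Re \<mu>)\<^sup>2) / m"
      using estimator_second_moment_le[where r = r, OF k'(1,2) A tr C rG] by (simp add: m_def T_def \<mu>_def)
    then have "meas_var X N ?\<sigma> ?f \<le> (T + (real m - 1) * (Re \<mu>)\<^sup>2) / m - (Re \<mu>)\<^sup>2"
      unfolding var by simp
    also have "\<dots> = (T - (Re \<mu>)\<^sup>2) / m" using m by (simp add: field_simps)
    also have "\<dots> \<le> (op_norm Obs)\<^sup>2 / m"
    proof (rule divide_right_mono)
      have "T \<le> (op_norm Obs)\<^sup>2"
        using trace_square_le_op_norm[where r = r, OF assms(2) C tr rG, folded A_def] by (simp add: T_def)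
      then show "T - (Re \<mu>)\<^sup>2 \<le> (op_norm Obs)\<^sup>2" using zero_le_power2[of "Re \<mu>"] by linarith
    qed simp
    also have "\<dots> \<le> (op_norm Obs)\<^sup>2 * (2 * real k / real n)"
    proof -
      \<comment> \<open>Rounding costs at most a factor 2: \<open>k \<le> n\<close> gives
        \<open>m \<ge> 1\<close>, so \<open>m + 1 \<le> 2 * m\<close>.\<close>
      have "n < (m + 1) * k" using k' by (simp add: m_def dividend_less_div_times)
      also have "\<dots> \<le> 2 * k * m" using m by (cases m) auto
      finally have "real n \<le> 2 * real k * real m"
        by (metis less_imp_le of_nat_le_iff of_nat_mult of_nat_numeral)
      then have "1 / real m \<le> 2 * real k / real n" using m k' by (simp add: field_simps)
      then have "(op_norm Obs)\<^sup>2 * (1 / real m) \<le> (op_norm Obs)\<^sup>2 * (2 * real k / real n)"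
        by (rule mult_left_mono) simp
      then show ?thesis by simp
    qed
    finally have "meas_var X N ?\<sigma> ?f \<le> 2 * real k * (op_norm Obs)\<^sup>2 / real n" by (simp add: mult_ac)
    moreover have "complex_of_real (meas_expect X N ?\<sigma> ?f) = mtrace (Obs * (\<rho> ^\<^sub>m k))"
      unfolding mean real unfolding \<mu>_def A_def r_def by (rule cyc_mean_mtrace[OF R Obs k'(1)])
    ultimately show ?thesis by blast
  qed
  ultimately show ?thesis using joint_resolutionD(2)[OF J] by blast
qed

end
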